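(* Let $m\in C_K$, $m\neq0$, let $\rho=-\theta_0-p-\frac{r'}{2r}$, $\nu=mr-\theta_0\rho$, and let $T_{1,m}:=QP_{1,m}Q^{-1}$. Then $$T_{1,m}=\frac1{2r}\begin{pmatrix}-\nu^2+\rho^2+\theta_0^2-1&{\rm i}(\nu^2+\rho^2-\theta_0^2-1)&2(\nu\rho+\theta_0)\\ {\rm i}(\nu^2-\rho^2+\theta_0^2-1)&\nu^2+\rho^2+\theta_0^2+1&2{\rm i}(\theta_0-\nu\rho)\\2(\nu\theta_0+\rho)&-2{\rm i}(\nu\theta_0-\rho)&2(\nu-\theta_0\rho)\end{pmatrix},$$ and $T_{1,m}$ is a Darboux transformation: the gauge transformation $\widetilde Z=T_{1,m}Z$ sends the system $[\Omega_m]\colon Z'=-(\Omega_0+mN_3)Z$ to the system $[\widetilde\Omega_m]\colon\widetilde Z'=-(\widetilde\Omega_0+mN_3)\widetilde Z$ of the same shape, where $\widetilde\Omega_0$ is still in $\mathfrak{so}(3)$ and the spectral part $N_3$ is untouched; and the Galoisian properties are preserved, i.e., when $\theta_0$ is algebraic over $K$ the identity components of the differential Galois groups of $[\Omega_m]$ over $K$ and of $[\widetilde\Omega_m]$ over $K(\theta_0)$ coincide, and when $\theta_0\in K$ the differential Galois groups over $K$ of $[\Omega_m]$ and $[\widetilde\Omega_m]$ coincide (as matrix groups with respect to fundamental matrices $\mathbf Z$ and $T_{1,m}\mathbf Z$).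
   Context: $K$ is a differential field of characteristic zero with algebraically closed field of constants $C_K$, ${\rm i}\in C_K$ with ${\rm i}^2=-1$. Let $p,q,r\in K$, $r\neq0$, $p=w'/w$ for some nonzero $w\in K$. Let $y_0$ be a nonzero solution of $y''+py'+qy=0$ (in a Picard--Vessiot extension of $K$), $\theta_0:=y_0'/y_0$, $\sqrt r$ a square root of $r$, and $$\tilde q:=y_0\sqrt r\left(\frac{p}{y_0\sqrt r}-\Big(\frac1{y_0\sqrt r}\Big)'\right)'.$$ Set $$Q=\begin{pmatrix}1&0&-1\\{\rm i}&0&{\rm i}\\0&-1&0\end{pmatrix},\qquad P_{1,m}=\frac1r\begin{pmatrix}\theta_0^2&-\theta_0&1\\-2\theta_0\nu&\nu-\theta_0\rho&2\rho\\ \nu^2&\rho\nu&\rho^2\end{pmatrix},$$ $$\Omega_0=\begin{pmatrix}0&{\rm i}p&q+1\\-{\rm i}p&0&-{\rm i}(q-1)\\-(q+1)&{\rm i}(q-1)&0\end{pmatrix},\quad N_3=r\begin{pmatrix}0&0&-1\\0&0&{\rm i}\\1&-{\rm i}&0\end{pmatrix},$$ and let $\widetilde\Omega_0$ be obtained from $\Omega_0$ by replacing $q$ by $\tilde q$. Here $\mathfrak{so}(3)$ denotes skew-symmetric $3\times 3$ matrices. A gauge transformation is an invertible linear change of the unknown vector. The differential Galois group is represented by matrices $M_\sigma$ with $\sigma(\mathbf Z)=\mathbf ZM_\sigma$ for a fundamental matrix $\mathbf Z$. *)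

theory Defs
  imports "HOL-Analysis.Analysis"
begin

section \<open>Differential subfields of an ambient differential field\<close>

text \<open>
  All fields occurring are subfields (sets) of one ambient differential field, the
  type \<open>'a\<close> with derivation \<open>D\<close>; extensions are inclusions of such sets.  The ambient
  field is arbitrary and carries no hypothesis of its own on its constants.
\<close>

definition derivation :: "('a::field \<Rightarrow> 'a) \<Rightarrow> bool" where
  "derivation D \<longleftrightarrow> (\<forall>x y. D (x + y) = D x + D y) \<and> (\<forall>x y. D (x * y) = D x * y + x * D y)"

definition is_subfield :: "'a::field set \<Rightarrow> bool" where
  "is_subfield K \<longleftrightarrow> 0 \<in> K \<and> 1 \<in> K \<and>
     (\<forall>x\<in>K. \<forall>y\<in>K. x + y \<in> K \<and> x * y \<in> K) \<and> (\<forall>x\<in>K. - x \<in> K \<and> inverse x \<in> K)"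

definition diff_subfield :: "('a::field \<Rightarrow> 'a) \<Rightarrow> 'a set \<Rightarrow> bool" where
  "diff_subfield D K \<longleftrightarrow> is_subfield K \<and> D ` K \<subseteq> K"

definition constants :: "('a::field \<Rightarrow> 'a) \<Rightarrow> 'a set \<Rightarrow> 'a set" where
  "constants D K = {c \<in> K. D c = 0}"

definition adjoin :: "'a::field set \<Rightarrow> 'a set \<Rightarrow> 'a set" where
  "adjoin K S = \<Inter> {L. is_subfield L \<and> K \<union> S \<subseteq> L}"

definition algebraic_over :: "'a::field set \<Rightarrow> 'a \<Rightarrow> bool" where
  "algebraic_over K x \<longleftrightarrow> (\<exists>f. f \<noteq> 0 \<and> (\<forall>k. coeff f k \<in> K) \<and> poly f x = 0)"

definition algebraically_closed :: "'a::field set \<Rightarrow> bool" where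
  "algebraically_closed C \<longleftrightarrow>
     (\<forall>f. (\<forall>k. coeff f k \<in> C) \<and> degree f > 0 \<longrightarrow> (\<exists>x\<in>C. poly f x = 0))"


section \<open>Linear differential systems and gauge transformations\<close>

definition entries :: "'a^'m^'n \<Rightarrow> 'a set" where
  "entries A = {A $ j $ k | j k. True}"

definition vderiv :: "('a \<Rightarrow> 'a) \<Rightarrow> 'a^'n \<Rightarrow> 'a^'n" where
  "vderiv D z = (\<chi> j. D (z $ j))"

definition mderiv :: "('a \<Rightarrow> 'a) \<Rightarrow> 'a^'m^'n \<Rightarrow> 'a^'m^'n" where
  "mderiv D A = map_matrix D A"

definition solves :: "('a::field \<Rightarrow> 'a) \<Rightarrow> 'a^'n^'n \<Rightarrow> 'a^'n \<Rightarrow> bool" where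
  "solves D A z \<longleftrightarrow> vderiv D z = A *v z"

definition fundamental_matrix :: "('a::field \<Rightarrow> 'a) \<Rightarrow> 'a^'n^'n \<Rightarrow> 'a^'n^'n \<Rightarrow> bool" where
  "fundamental_matrix D A Z \<longleftrightarrow> invertible Z \<and> mderiv D Z = A ** Z"

text \<open>
  If \<open>z' = A z\<close> and \<open>w = T z\<close>, then \<open>w' = (T' + T A) T\<^sup>-\<^sup>1 w\<close>.  The coefficient matrix of the
  transformed system is recorded as such, so that the statement has content even when
  the ambient field contains few solutions.
\<close>

definition gauge :: "('a::field \<Rightarrow> 'a) \<Rightarrow> 'a^'n^'n \<Rightarrow> 'a^'n^'n \<Rightarrow> 'a^'n^'n" where
  "gauge D T A = (mderiv D T + T ** A) ** matrix_inv T"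

definition gauge_transformation ::
    "('a::field \<Rightarrow> 'a) \<Rightarrow> 'a^'n^'n \<Rightarrow> 'a^'n^'n \<Rightarrow> 'a^'n^'n \<Rightarrow> bool" where
  "gauge_transformation D T A B \<longleftrightarrow>
     invertible T \<and> gauge D T A = B \<and> (\<forall>z. solves D A z \<longleftrightarrow> solves D B (T *v z))"


section \<open>Picard--Vessiot extensions and differential Galois groups\<close>

text \<open>
  \<open>picard_vessiot D K A Z\<close>: \<open>Z\<close> is a fundamental matrix of \<open>z' = A z\<close>, \<open>A\<close> over \<open>K\<close>, and
  \<open>K(Z) = adjoin K (entries Z)\<close> is a Picard--Vessiot extension of \<open>K\<close> for this system.
  Closure of \<open>K(Z)\<close> under \<open>D\<close> follows from \<open>Z' = A Z\<close>.
\<close>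

definition picard_vessiot ::
    "('a::field \<Rightarrow> 'a) \<Rightarrow> 'a set \<Rightarrow> 'a^'n^'n \<Rightarrow> 'a^'n^'n \<Rightarrow> bool" where
  "picard_vessiot D K A Z \<longleftrightarrow>
     diff_subfield D K \<and> entries A \<subseteq> K \<and> fundamental_matrix D A Z \<and>
     constants D (adjoin K (entries Z)) = constants D K"

text \<open>
  Automorphisms of a subset are functions on the ambient type, made unique by
  extensionality outside \<open>L\<close>.
\<close>

definition diff_automorphisms :: "('a::field \<Rightarrow> 'a) \<Rightarrow> 'a set \<Rightarrow> 'a set \<Rightarrow> ('a \<Rightarrow> 'a) set" where
  "diff_automorphisms D K L = {\<sigma> \<in> extensional L. bij_betw \<sigma> L L \<and>
     (\<forall>x\<in>L. \<forall>y\<in>L. \<sigma> (x + y) = \<sigma> x + \<sigma> y \<and> \<sigma> (x * y) = \<sigma> x * \<sigma> y) \<and>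
     (\<forall>x\<in>L. \<sigma> (D x) = D (\<sigma> x)) \<and> (\<forall>x\<in>K. \<sigma> x = x)}"

definition diff_galois_group :: "('a::field \<Rightarrow> 'a) \<Rightarrow> 'a set \<Rightarrow> 'a^'n^'n \<Rightarrow> ('a^'n^'n) set" where
  "diff_galois_group D K Z =
     {M. \<exists>\<sigma> \<in> diff_automorphisms D K (adjoin K (entries Z)). map_matrix \<sigma> Z = Z ** M}"

inductive_set matrix_polys :: "'a::comm_ring_1 set \<Rightarrow> ('a^'n^'n \<Rightarrow> 'a) set"
  for C :: "'a set" where
  const: "c \<in> C \<Longrightarrow> (\<lambda>M. c) \<in> matrix_polys C"
| entry: "(\<lambda>M. M $ j $ k) \<in> matrix_polys C"
| add: "f \<in> matrix_polys C \<Longrightarrow> g \<in> matrix_polys C \<Longrightarrow> (\<lambda>M. f M + g M) \<in> matrix_polys C"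
| mult: "f \<in> matrix_polys C \<Longrightarrow> g \<in> matrix_polys C \<Longrightarrow> (\<lambda>M. f M * g M) \<in> matrix_polys C"

text \<open>
  The Zariski topology on the matrices with entries in \<open>C\<close>: open sets are the complements
  of common zero sets of polynomials in the matrix entries.  On invertible matrices it
  induces the usual topology of \<open>GL\<^sub>n(C)\<close>, since the determinant does not vanish there.
\<close>

definition zariski_open :: "'a::comm_ring_1 set \<Rightarrow> ('a^'n^'n) set \<Rightarrow> bool" where
  "zariski_open C U \<longleftrightarrow>
     (\<exists>F \<subseteq> matrix_polys C. U = {M. entries M \<subseteq> C \<and> (\<exists>f\<in>F. f M \<noteq> 0)})"

definition zariski :: "'a::comm_ring_1 set \<Rightarrow> ('a^'n^'n) topology" where
  "zariski C = topology (zariski_open C)"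

lemma istopology_zariski_open:
  fixes C :: "'a::idom set"
  shows "istopology (zariski_open C :: ('a^'n^'n) set \<Rightarrow> bool)"
  unfolding istopology_def
proof (intro conjI allI impI)
  fix U V :: "('a^'n^'n) set"
  assume "zariski_open C U" "zariski_open C V"
  then obtain F G where F: "F \<subseteq> matrix_polys C" "U = {M. entries M \<subseteq> C \<and> (\<exists>f\<in>F. f M \<noteq> 0)}"
    and G: "G \<subseteq> matrix_polys C" "V = {M. entries M \<subseteq> C \<and> (\<exists>f\<in>G. f M \<noteq> 0)}"
    unfolding zariski_open_def by (elim exE conjE)
  define H where "H = (\<lambda>(f, g) M. f M * g M) ` (F \<times> G)"
  have "H \<subseteq> matrix_polys C"
    using F(1) G(1) unfolding H_def by (auto intro!: matrix_polys.mult)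
  moreover have "(\<exists>h\<in>H. h M \<noteq> 0) \<longleftrightarrow> (\<exists>f\<in>F. f M \<noteq> 0) \<and> (\<exists>g\<in>G. g M \<noteq> 0)" for M
    unfolding H_def by (simp add: Bex_def) metis
  then have "U \<inter> V = {M. entries M \<subseteq> C \<and> (\<exists>h\<in>H. h M \<noteq> 0)}"
    unfolding F(2) G(2) by (simp add: Int_def conj_ac)
  ultimately show "zariski_open C (U \<inter> V)"
    unfolding zariski_open_def by (intro exI[of _ H] conjI)
next
  fix \<U> :: "('a^'n^'n) set set"
  assume "\<forall>U\<in>\<U>. zariski_open C U"
  then have "\<forall>U\<in>\<U>. \<exists>F. F \<subseteq> matrix_polys C \<and> U = {M. entries M \<subseteq> C \<and> (\<exists>f\<in>F. f M \<noteq> 0)}"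
    unfolding zariski_open_def .
  then obtain F where F: "\<forall>U\<in>\<U>. F U \<subseteq> matrix_polys C \<and>
      U = {M. entries M \<subseteq> C \<and> (\<exists>f\<in>F U. f M \<noteq> 0)}"
    by (rule bchoice[THEN exE])
  have "M \<in> \<Union>\<U> \<longleftrightarrow> entries M \<subseteq> C \<and> (\<exists>f\<in>(\<Union>U\<in>\<U>. F U). f M \<noteq> 0)" for M
  proof -
    have "M \<in> U \<longleftrightarrow> entries M \<subseteq> C \<and> (\<exists>f\<in>F U. f M \<noteq> 0)" if "U \<in> \<U>" for U
      by (subst conjunct2[OF bspec[OF F that]]) (rule mem_Collect_eq)
    then show ?thesis by auto
  qed
  then have "\<Union>\<U> = {M. entries M \<subseteq> C \<and> (\<exists>f\<in>(\<Union>U\<in>\<U>. F U). f M \<noteq> 0)}"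
    by (intro set_eqI) simp
  moreover have "(\<Union>U\<in>\<U>. F U) \<subseteq> matrix_polys C"
    using F by (simp add: UN_subset_iff)
  ultimately show "zariski_open C (\<Union>\<U>)"
    unfolding zariski_open_def by (intro exI[of _ "\<Union>U\<in>\<U>. F U"] conjI)
qed

lemma openin_zariski: "openin (zariski C) U \<longleftrightarrow> zariski_open C U" for C :: "'a::idom set"
  unfolding zariski_def by (simp add: topology_inverse' istopology_zariski_open)

lemma topspace_zariski:
  fixes C :: "'a::idom set"
  assumes "1 \<in> C"
  shows "topspace (zariski C :: ('a^'n^'n) topology) = {M. entries M \<subseteq> C}"
proof
  have "zariski_open C {M :: 'a^'n^'n. entries M \<subseteq> C}"
    unfolding zariski_open_def
    by (intro exI[of _ "{\<lambda>M. 1}"]) (simp add: assms matrix_polys.const)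
  then show "{M. entries M \<subseteq> C} \<subseteq> topspace (zariski C :: ('a^'n^'n) topology)"
    by (simp add: openin_zariski openin_subset)
  have "zariski_open C (topspace (zariski C :: ('a^'n^'n) topology))"
    using openin_topspace openin_zariski by metis
  then show "topspace (zariski C :: ('a^'n^'n) topology) \<subseteq> {M. entries M \<subseteq> C}"
    unfolding zariski_open_def by (elim exE conjE) (simp add: subset_iff)
qed

definition galois_identity_component ::
    "('a::field \<Rightarrow> 'a) \<Rightarrow> 'a set \<Rightarrow> 'a^'n^'n \<Rightarrow> ('a^'n^'n) set" where
  "galois_identity_component D K Z =
     connected_component_of_set
       (subtopology (zariski (constants D K)) (diff_galois_group D K Z)) (mat 1)"


section \<open>The matrices\<close>

definition so3 :: "'a::field set \<Rightarrow> ('a^3^3) set" where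
  "so3 K = {A. entries A \<subseteq> K \<and> transpose A = - A}"

definition mscale :: "'a::times \<Rightarrow> 'a^'m^'n \<Rightarrow> 'a^'m^'n" where
  "mscale c A = map_matrix (\<lambda>x. c * x) A"

text \<open>Throughout, \<open>\<iota>\<close> is a square root of \<open>-1\<close>.\<close>

definition matQ :: "'a::field \<Rightarrow> 'a^3^3" where
  "matQ \<iota> = vector [vector [1, 0, - 1], vector [\<iota>, 0, \<iota>], vector [0, - 1, 0]]"

definition matP :: "'a::field \<Rightarrow> 'a \<Rightarrow> 'a \<Rightarrow> 'a \<Rightarrow> 'a^3^3" where
  "matP r \<theta> \<rho> \<nu> = mscale (1 / r) (vector
     [vector [\<theta>\<^sup>2, - \<theta>, 1],
      vector [- (2 * \<theta> * \<nu>), \<nu> - \<theta> * \<rho>, 2 * \<rho>],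
      vector [\<nu>\<^sup>2, \<rho> * \<nu>, \<rho>\<^sup>2]])"

definition Omega0 :: "'a::field \<Rightarrow> 'a \<Rightarrow> 'a \<Rightarrow> 'a^3^3" where
  "Omega0 \<iota> p q = vector
     [vector [0, \<iota> * p, q + 1],
      vector [- (\<iota> * p), 0, - (\<iota> * (q - 1))],
      vector [- (q + 1), \<iota> * (q - 1), 0]]"

definition N3 :: "'a::field \<Rightarrow> 'a \<Rightarrow> 'a^3^3" where
  "N3 \<iota> r = mscale r (vector [vector [0, 0, - 1], vector [0, 0, \<iota>], vector [1, - \<iota>, 0]])"

text \<open>The coefficient matrix of \<open>Z' = - (\<Omega>\<^sub>0 + m N\<^sub>3) Z\<close>.\<close>

definition Sys :: "'a::field \<Rightarrow> 'a \<Rightarrow> 'a \<Rightarrow> 'a \<Rightarrow> 'a \<Rightarrow> 'a^3^3" where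
  "Sys \<iota> p q r m = - (Omega0 \<iota> p q + mscale m (N3 \<iota> r))"

end

theory Submission
  imports Defs "HOL-Computational_Algebra.Polynomial_Factorial"
begin

text \<open>
  Conjugation by \<open>Q\<close> turns the system into a twisted symmetric square of
  \<open>y'' + p y' + (q - m r) y = 0\<close>.  Both \<open>\<theta>\<^sub>0\<close> and \<open>\<rho>\<close> satisfy Riccati equations (for \<open>q\<close> and for the
  transformed potential, respectively), and with these the gauge equation is a polynomial identity.

  The matrix \<open>T\<close> has entries in \<open>K(\<theta>\<^sub>0)\<close>, so over that field the gauge transformation changes neither
  the Picard-Vessiot extension nor the matrices of its automorphisms.  It remains to compare \<open>Z\<close> over
  \<open>K\<close> and over \<open>K(\<theta>\<^sub>0)\<close> when \<open>\<theta>\<^sub>0\<close> is algebraic.  A constant of \<open>K(Z)(\<theta>\<^sub>0)\<close> is algebraic over the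
  constants of \<open>K\<close>, hence one of them.  If \<open>g\<close> is the minimal polynomial of \<open>\<theta>\<^sub>0\<close> over \<open>K(Z)\<close>, an
  automorphism of \<open>K(Z)\<close> extends to one fixing \<open>\<theta>\<^sub>0\<close> as soon as it fixes \<open>g\<close>.  The orbit of \<open>g\<close> under
  the Galois group is finite, since it consists of monic divisors of one polynomial over \<open>K\<close>, and
  each fibre of the orbit map is Zariski closed; hence the stabiliser of \<open>g\<close> is open and closed and
  contains the identity component.
\<close>

section \<open>Derivations and subfields\<close>

lemma derivation_add: "derivation D \<Longrightarrow> D (x + y) = D x + D y"
  and derivation_mult: "derivation D \<Longrightarrow> D (x * y) = D x * y + x * D y"
  by (simp_all add: derivation_def)

lemma derivation_0: "derivation D \<Longrightarrow> D 0 = 0"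
  using derivation_add[of D 0 0] by (metis add_0 add_cancel_right_right)

lemma derivation_1: "derivation D \<Longrightarrow> D 1 = 0"
  using derivation_mult[of D 1 1] by (metis add_cancel_right_right mult_1 mult_1_right)

lemma derivation_minus: "derivation D \<Longrightarrow> D (- x) = - D x"
  using derivation_add[of D x "- x"] derivation_0[of D] by (simp add: add_eq_0_iff)

lemma derivation_diff: "derivation D \<Longrightarrow> D (x - y) = D x - D y"
  using derivation_add[of D x "- y"] by (simp add: derivation_minus)

lemma derivation_inverse:
  assumes "derivation D" "x \<noteq> 0"
  shows "D (inverse x) = - D x / x\<^sup>2"
proof -
  have "D x * inverse x + x * D (inverse x) = 0"
    using derivation_mult[OF assms(1), of x "inverse x"] assms derivation_1[OF assms(1)] by simp
  then have "D (inverse x) = - (D x * inverse x) / x"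
    using assms(2) by (simp add: eq_divide_eq add_eq_0_iff2 mult.commute)
  then show ?thesis
    by (simp add: field_simps power2_eq_square)
qed

lemma derivation_divide:
  assumes "derivation D" "y \<noteq> 0"
  shows "D (x / y) = (D x * y - x * D y) / y\<^sup>2"
proof -
  have "D (x / y) = D x / y - x * D y / y\<^sup>2"
    by (simp add: divide_inverse[of x] derivation_mult[OF assms(1)] derivation_inverse[OF assms]
        divide_inverse[of "D x"])
  also have "\<dots> = (D x * y - x * D y) / y\<^sup>2"
    using assms(2) by (simp add: diff_divide_distrib power2_eq_square)
  finally show ?thesis .
qed

lemma derivation_numeral: "derivation D \<Longrightarrow> D (numeral k) = 0"
  by (induction k rule: num_induct)
     (simp_all only: derivation_1 numeral_One numeral_inc derivation_add add_0)

lemma derivation_sum: "derivation D \<Longrightarrow> D (sum f A) = (\<Sum>x\<in>A. D (f x))"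
  by (induction A rule: infinite_finite_induct) (simp_all add: derivation_0 derivation_add)

context
  fixes F :: "'a::field set"
  assumes F: "is_subfield F"
begin

lemma subfield_0: "0 \<in> F" and subfield_1: "1 \<in> F"
  using F by (simp_all add: is_subfield_def)

lemma subfield_add: "x \<in> F \<Longrightarrow> y \<in> F \<Longrightarrow> x + y \<in> F"
  and subfield_mult: "x \<in> F \<Longrightarrow> y \<in> F \<Longrightarrow> x * y \<in> F"
  and subfield_minus: "x \<in> F \<Longrightarrow> - x \<in> F"
  and subfield_inverse: "x \<in> F \<Longrightarrow> inverse x \<in> F"
  using F by (simp_all add: is_subfield_def)

lemma subfield_diff: "x \<in> F \<Longrightarrow> y \<in> F \<Longrightarrow> x - y \<in> F"
  using subfield_add[of x "- y"] subfield_minus by simp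

lemma subfield_divide: "x \<in> F \<Longrightarrow> y \<in> F \<Longrightarrow> x / y \<in> F"
  using subfield_mult[of x "inverse y"] subfield_inverse by (simp add: divide_inverse)

lemma subfield_power: "x \<in> F \<Longrightarrow> x ^ n \<in> F"
  by (induction n) (simp_all add: subfield_1 subfield_mult)

lemma subfield_numeral: "numeral k \<in> F"
  by (induction k rule: num_induct) (simp_all only: subfield_1 numeral_One numeral_inc subfield_add)

lemma subfield_sum: "(\<And>x. x \<in> A \<Longrightarrow> f x \<in> F) \<Longrightarrow> sum f A \<in> F"
  by (induction A rule: infinite_finite_induct) (simp_all add: subfield_0 subfield_add)

lemma subfield_prod: "(\<And>x. x \<in> A \<Longrightarrow> f x \<in> F) \<Longrightarrow> prod f A \<in> F"
  by (induction A rule: infinite_finite_induct) (simp_all add: subfield_1 subfield_mult)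

lemmas subfield_closed = subfield_0 subfield_1 subfield_add subfield_mult subfield_minus
  subfield_inverse subfield_diff subfield_divide subfield_power subfield_numeral

end

section \<open>Constants and generated subfields\<close>

lemma subfield_constants:
  assumes "derivation D" "is_subfield K"
  shows "is_subfield (constants D K)"
proof -
  have "D (inverse x) = 0" if "D x = 0" for x
    using derivation_inverse[OF assms(1), of x] that derivation_0[OF assms(1)]
    by (cases "x = 0") simp_all
  with assms show ?thesis
    by (auto simp: is_subfield_def constants_def derivation_0 derivation_1 derivation_add
        derivation_mult derivation_minus)
qed

lemma subfield_adjoin: "is_subfield (adjoin K S)"
  unfolding adjoin_def is_subfield_def by auto

lemma adjoin_superset: "K \<subseteq> adjoin K S" and generators_adjoin: "S \<subseteq> adjoin K S"
  unfolding adjoin_def by auto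

lemma adjoin_least: "is_subfield L \<Longrightarrow> K \<subseteq> L \<Longrightarrow> S \<subseteq> L \<Longrightarrow> adjoin K S \<subseteq> L"
  unfolding adjoin_def by auto

lemma adjoin_mono: "K \<subseteq> K' \<Longrightarrow> S \<subseteq> adjoin K' S' \<Longrightarrow> adjoin K S \<subseteq> adjoin K' S'"
  by (meson adjoin_least subfield_adjoin adjoin_superset order_trans)

lemma adjoin_commute: "adjoin (adjoin K S) S' = adjoin (adjoin K S') S"
proof -
  have "adjoin (adjoin K S) S' \<subseteq> adjoin (adjoin K S') S" for S S' :: "'a set"
    by (intro adjoin_least subfield_adjoin)
       (meson adjoin_superset generators_adjoin order_trans)+
  then show ?thesis by blast
qed

lemma adjoin_absorb: "is_subfield K \<Longrightarrow> S \<subseteq> K \<Longrightarrow> adjoin K S = K"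
  by (intro equalityI adjoin_least adjoin_superset) auto

text \<open>The elements of \<open>adjoin K S\<close> whose derivative stays in
  \<open>adjoin K S\<close> form a subfield containing \<open>K\<close> and \<open>S\<close>, so
  they exhaust it.\<close>

lemma diff_subfield_adjoin:
  assumes D: "derivation D" and K: "diff_subfield D K"
    and S: "\<And>x. x \<in> S \<Longrightarrow> D x \<in> adjoin K S"
  shows "diff_subfield D (adjoin K S)"
proof -
  let ?L = "adjoin K S"
  note cl = subfield_closed[OF subfield_adjoin[of K S]]
  have "is_subfield {x \<in> ?L. D x \<in> ?L}"
  proof -
    have "D (inverse x) \<in> ?L" if "x \<in> ?L" "D x \<in> ?L" for x
      using derivation_inverse[OF D, of x] derivation_0[OF D] that
      by (cases "x = 0") (simp_all add: cl)
    then show ?thesis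
      by (simp add: is_subfield_def cl derivation_0[OF D] derivation_1[OF D]
          derivation_add[OF D] derivation_mult[OF D] derivation_minus[OF D])
  qed
  then have "?L \<subseteq> {x \<in> ?L. D x \<in> ?L}"
    using K S adjoin_superset[of K S] generators_adjoin[of S K]
    by (intro adjoin_least) (auto simp: diff_subfield_def)
  then show ?thesis
    by (auto simp: diff_subfield_def subfield_adjoin)
qed


section \<open>Matrices over a subfield\<close>

lemma entries_subset_iff: "entries A \<subseteq> F \<longleftrightarrow> (\<forall>i j. A $ i $ j \<in> F)"
  by (auto simp: entries_def)

lemma matrix_mult_nth: "(A ** B) $ i $ j = (\<Sum>k\<in>UNIV. A $ i $ k * B $ k $ j)"
  by (simp add: matrix_matrix_mult_def)

lemma entries_matrix_mult:
  "is_subfield F \<Longrightarrow> entries A \<subseteq> F \<Longrightarrow> entries B \<subseteq> F \<Longrightarrow> entries (A ** B) \<subseteq> F"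
  unfolding entries_subset_iff matrix_mult_nth
  by (blast intro: subfield_sum subfield_mult)

lemma entries_mat_1: "is_subfield F \<Longrightarrow> entries (mat 1) \<subseteq> F"
  by (simp add: entries_subset_iff mat_def subfield_closed)

lemma det_in_subfield:
  assumes "is_subfield F" "entries A \<subseteq> F"
  shows "det A \<in> F"
proof -
  have "of_int (sign \<pi>) * (\<Prod>i\<in>UNIV. A $ i $ \<pi> i) \<in> F" for \<pi>
    using assms(2) subfield_prod[OF assms(1), of UNIV "\<lambda>i. A $ i $ \<pi> i"]
    by (simp add: sign_def entries_subset_iff subfield_closed[OF assms(1)])
  then show ?thesis
    unfolding det_def by (simp add: subfield_sum[OF assms(1)])
qed

lemma matrix_inv_field:
  fixes A :: "'a::field^'n^'n"
  assumes "invertible A"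
  shows "A ** matrix_inv A = mat 1" "matrix_inv A ** A = mat 1"
proof -
  have "A ** matrix_inv A = mat 1 \<and> matrix_inv A ** A = mat 1"
    unfolding matrix_inv_def using assms invertible_def by (metis (mono_tags, lifting) someI_ex)
  then show "A ** matrix_inv A = mat 1" "matrix_inv A ** A = mat 1" by auto
qed

lemma invertible_matrix_inv: "invertible A \<Longrightarrow> invertible (matrix_inv A)"
  for A :: "'a::field^'n^'n"
  using matrix_inv_field invertible_def by blast

text \<open>Cramer's rule, applied to the columns of the inverse, expresses every entry as a
  quotient of two determinants over \<open>F\<close>.\<close>

lemma entries_matrix_inv:
  fixes A :: "'a::field^'n^'n"
  assumes F: "is_subfield F" and A: "entries A \<subseteq> F" "invertible A"
  shows "entries (matrix_inv A) \<subseteq> F"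
  unfolding entries_subset_iff
proof (intro allI)
  fix i j
  let ?x = "\<chi> i. matrix_inv A $ i $ j" and ?b = "\<chi> i. (mat 1 :: 'a^'n^'n) $ i $ j"
  have "A *v ?x = ?b"
    using matrix_inv_field(1)[OF A(2)]
    by (simp add: vec_eq_iff matrix_vector_mult_def matrix_mult_nth)
  then have "?x = (\<chi> k. det (\<chi> i j. if j = k then ?b $ i else A $ i $ j) / det A)"
    using A(2) cramer invertible_det_nz by blast
  then have "matrix_inv A $ i $ j = det (\<chi> k l. if l = i then ?b $ k else A $ k $ l) / det A"
    by (metis (no_types, lifting) vec_lambda_beta)
  moreover have "det (\<chi> k l. if l = i then ?b $ k else A $ k $ l) \<in> F"
    using A(1) entries_mat_1[OF F, where 'b='n]
    by (intro det_in_subfield[OF F]) (simp add: entries_subset_iff)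
  ultimately show "matrix_inv A $ i $ j \<in> F"
    by (simp add: subfield_divide[OF F] det_in_subfield[OF F A(1)])
qed

section \<open>Differentiation of matrices and the gauge equation\<close>

lemma mderiv_mult:
  "derivation D \<Longrightarrow> mderiv D (A ** B) = mderiv D A ** B + A ** mderiv D B"
  for A :: "'a::field^'m^'n"
  by (simp add: vec_eq_iff mderiv_def matrix_mult_nth derivation_sum derivation_mult sum.distrib)

lemma vderiv_mult:
  "derivation D \<Longrightarrow> vderiv D (A *v z) = mderiv D A *v z + A *v vderiv D z"
  for A :: "'a::field^'m^'n"
  by (simp add: vec_eq_iff mderiv_def vderiv_def matrix_vector_mult_def derivation_sum
      derivation_mult sum.distrib)

lemma matrix_mult_left_cancel:
  fixes T :: "'a::field^'n^'n"
  assumes "invertible T"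
  shows "T ** A = T ** B \<longleftrightarrow> A = B"
  by (metis assms matrix_inv_field(2) matrix_mul_assoc matrix_mul_lid)

text \<open>Both \<open>T\<close> and its inverse have entries in \<open>K\<close>, so each of
  \<open>Z\<close> and \<open>T ** Z\<close> is obtained from the other by operations over
  \<open>K\<close>.\<close>

lemma adjoin_entries_mult:
  fixes T :: "'a::field^'n^'n"
  assumes "entries T \<subseteq> K" "is_subfield K" "invertible T"
  shows "adjoin K (entries (T ** Z)) = adjoin K (entries Z)"
proof
  show "adjoin K (entries (T ** Z)) \<subseteq> adjoin K (entries Z)"
    using assms adjoin_superset[of K "entries Z"]
    by (intro adjoin_mono order_refl entries_matrix_mult subfield_adjoin generators_adjoin) auto
  have "Z = matrix_inv T ** (T ** Z)"
    by (simp add: matrix_mul_assoc matrix_inv_field assms)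
  moreover have "entries (matrix_inv T ** (T ** Z)) \<subseteq> adjoin K (entries (T ** Z))"
    using entries_matrix_inv[OF assms(2,1,3)] adjoin_superset[of K "entries (T ** Z)"]
    by (intro entries_matrix_mult subfield_adjoin generators_adjoin) auto
  ultimately show "adjoin K (entries Z) \<subseteq> adjoin K (entries (T ** Z))"
    by (intro adjoin_mono order_refl) simp
qed

text \<open>Multiplying the definition of \<open>gauge\<close> by \<open>T\<close> on the right
  removes the inverse and leaves an identity that can be checked entrywise. Applied to
  \<open>z\<close>, it turns the equation for \<open>T z\<close> into \<open>T z' = T A z\<close>,
  where \<open>T\<close> cancels.\<close>

lemma gauge_transformationI:
  fixes T :: "'a::field^'n^'n"
  assumes D: "derivation D" and T: "invertible T" and eq: "mderiv D T + T ** A = B ** T"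
  shows "gauge_transformation D T A B"
proof -
  have "gauge D T A = B"
    unfolding gauge_def eq by (simp add: matrix_mul_assoc[symmetric] matrix_inv_field[OF T])
  moreover have "solves D A z \<longleftrightarrow> solves D B (T *v z)" for z
  proof -
    have "B *v (T *v z) = mderiv D T *v z + T *v (A *v z)"
      by (simp add: matrix_vector_mul_assoc eq[symmetric] matrix_vector_mult_add_rdistrib)
    then have "solves D B (T *v z) \<longleftrightarrow> T *v vderiv D z = T *v (A *v z)"
      by (simp add: solves_def vderiv_mult[OF D])
    also have "\<dots> \<longleftrightarrow> solves D A z"
      unfolding solves_def
      by (metis T matrix_inv_field(2) matrix_vector_mul_assoc matrix_vector_mul_lid)
    finally show ?thesis by simp
  qed
  ultimately show ?thesis
    using T by (simp add: gauge_transformation_def)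
qed

lemma gauge_transformationD:
  fixes T :: "'a::field^'n^'n"
  assumes "gauge_transformation D T A B"
  shows "invertible T" "mderiv D T + T ** A = B ** T"
  using assms
  by (auto simp: gauge_transformation_def gauge_def matrix_mul_assoc[symmetric] matrix_inv_field)

section \<open>Polynomials over a subfield\<close>

text \<open>Fields are sets inside one type, so polynomials over a subfield are ambient polynomials
  with restricted coefficients.\<close>

definition polys_over :: "'a::field set \<Rightarrow> 'a poly set" where
  "polys_over L = {f. \<forall>k. coeff f k \<in> L}"

lemma polys_over_mono: "K \<subseteq> L \<Longrightarrow> polys_over K \<subseteq> polys_over L"
  by (auto simp: polys_over_def)

lemma poly_in_subfield:
  assumes "is_subfield L" "f \<in> polys_over L" "x \<in> L"
  shows "poly f x \<in> L"
  using assms by (auto simp: polys_over_def poly_altdef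
      intro!: subfield_sum[OF assms(1)] subfield_mult[OF assms(1)] subfield_power[OF assms(1)])

context
  fixes L :: "'a::field set"
  assumes L: "is_subfield L"
begin

lemma polys_over_0: "0 \<in> polys_over L"
  by (simp add: polys_over_def subfield_0[OF L])

lemma polys_over_add: "f \<in> polys_over L \<Longrightarrow> g \<in> polys_over L \<Longrightarrow> f + g \<in> polys_over L"
  by (simp add: polys_over_def subfield_add[OF L])

lemma polys_over_diff: "f \<in> polys_over L \<Longrightarrow> g \<in> polys_over L \<Longrightarrow> f - g \<in> polys_over L"
  by (simp add: polys_over_def subfield_diff[OF L])

lemma polys_over_minus: "f \<in> polys_over L \<Longrightarrow> - f \<in> polys_over L"
  by (simp add: polys_over_def subfield_minus[OF L])

lemma polys_over_mult: "f \<in> polys_over L \<Longrightarrow> g \<in> polys_over L \<Longrightarrow> f * g \<in> polys_over L"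
  by (auto simp: polys_over_def coeff_mult intro!: subfield_sum[OF L] subfield_mult[OF L])

lemma polys_over_smult: "c \<in> L \<Longrightarrow> f \<in> polys_over L \<Longrightarrow> smult c f \<in> polys_over L"
  by (simp add: polys_over_def subfield_mult[OF L])

lemma polys_over_pCons: "pCons c f \<in> polys_over L \<longleftrightarrow> c \<in> L \<and> f \<in> polys_over L"
  unfolding polys_over_def mem_Collect_eq by (metis coeff_pCons_0 coeff_pCons_Suc not0_implies_Suc)

lemma polys_over_monom: "c \<in> L \<Longrightarrow> monom c n \<in> polys_over L"
  by (simp add: polys_over_def subfield_0[OF L])

text \<open>Since \<open>g\<close> is monic, long division never divides coefficients, so quotient
  and remainder stay over \<open>L\<close>; each round of the induction cancels the leading term of
  \<open>h\<close>.\<close>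

lemma polys_over_division:
  assumes g: "g \<in> polys_over L" "lead_coeff g = 1" and h: "h \<in> polys_over L"
  obtains q s where "q \<in> polys_over L" "s \<in> polys_over L" "h = g * q + s"
    "s = 0 \<or> degree s < degree g"
proof -
  have "\<exists>q\<in>polys_over L. \<exists>s\<in>polys_over L. h = g * q + s \<and> (s = 0 \<or> degree s < degree g)"
    using h
  proof (induction "degree h" arbitrary: h rule: less_induct)
    case less
    show ?case
    proof (cases "h = 0 \<or> degree h < degree g")
      case True
      then show ?thesis
        using less.prems polys_over_0 by (intro bexI[of _ 0] bexI[of _ h]) auto
    next
      case False
      define t where "t = monom (lead_coeff h) (degree h - degree g)"
      have t: "t \<in> polys_over L"
        using less.prems unfolding t_def by (intro polys_over_monom) (simp add: polys_over_def)
      define h' where "h' = h - g * t"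
      have h': "h' \<in> polys_over L"
        unfolding h'_def by (intro polys_over_diff polys_over_mult less.prems g t)
      have "g \<noteq> 0" using g(2) by auto
      then have deg_gt: "degree (g * t) = degree h"
        using False by (auto simp: t_def degree_mult_eq degree_monom_eq monom_eq_0_iff)
      have "lead_coeff (g * t) = lead_coeff h"
        unfolding lead_coeff_mult using False by (simp add: g(2) t_def degree_monom_eq)
      then have "coeff h' (degree h) = 0"
        by (simp add: h'_def deg_gt)
      moreover have "degree h' \<le> degree h"
        unfolding h'_def using deg_gt by (intro degree_diff_le) simp_all
      ultimately have "h' = 0 \<or> degree h' < degree h"
        by (metis le_neq_implies_less leading_coeff_0_iff)
      then have "\<exists>q\<in>polys_over L. \<exists>s\<in>polys_over L. h' = g * q + s \<and> (s = 0 \<or> degree s < degree g)"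
        using less.hyps[OF _ h'] polys_over_0 by (elim disjE) (force, blast)
      then obtain q s where "q \<in> polys_over L" "s \<in> polys_over L" "h' = g * q + s"
        "s = 0 \<or> degree s < degree g" by blast
      then show ?thesis
        by (intro bexI[of _ "q + t"] bexI[of _ s]) (auto simp: h'_def algebra_simps polys_over_add t)
    qed
  qed
  then show ?thesis using that by blast
qed

text \<open>A nonzero annihilating polynomial of least degree over \<open>L\<close> is made monic.
  The remainder of any other one modulo it vanishes at \<open>x\<close> and has smaller degree,
  hence is zero.\<close>

lemma minimal_polynomial:
  assumes "algebraic_over L x"
  obtains g where "g \<in> polys_over L" "lead_coeff g = 1" "poly g x = 0"
    "\<And>h. h \<in> polys_over L \<Longrightarrow> poly h x = 0 \<Longrightarrow> \<exists>q\<in>polys_over L. h = g * q"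
    "\<And>h. h \<in> polys_over L \<Longrightarrow> poly h x = 0 \<Longrightarrow> h = 0 \<or> degree g \<le> degree h"
proof -
  define P where "P h \<longleftrightarrow> h \<in> polys_over L \<and> h \<noteq> 0 \<and> poly h x = 0" for h
  obtain f where "P f"
    using assms by (auto simp: algebraic_over_def P_def polys_over_def)
  then obtain g0 where g0: "P g0" and min: "\<And>h. P h \<Longrightarrow> degree g0 \<le> degree h"
    using ex_has_least_nat[of P f degree] by auto
  define g where "g = smult (inverse (lead_coeff g0)) g0"
  have "lead_coeff g0 \<in> L" "lead_coeff g0 \<noteq> 0"
    using g0 by (auto simp: P_def polys_over_def)
  then have g: "g \<in> polys_over L" "lead_coeff g = 1" "poly g x = 0" "degree g = degree g0"
    using g0 by (auto simp: g_def P_def intro!: polys_over_smult subfield_inverse[OF L])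
  have min': "h = 0 \<or> degree g \<le> degree h" if "h \<in> polys_over L" "poly h x = 0" for h
    using min[of h] that by (auto simp: P_def g(4))
  have "\<exists>q\<in>polys_over L. h = g * q" if h: "h \<in> polys_over L" "poly h x = 0" for h
  proof -
    obtain q s where q: "q \<in> polys_over L" and s: "s \<in> polys_over L" "h = g * q + s"
      "s = 0 \<or> degree s < degree g"
      using polys_over_division[OF g(1,2) h(1)] .
    have "poly s x = 0"
      using h(2) g(3) unfolding s(2) by simp
    then have "s = 0" using min'[OF s(1)] s(3) by auto
    then show ?thesis using q s by auto
  qed
  then show ?thesis using that[OF g(1-3)] min' by blast
qed

text \<open>Gaussian elimination, carried out by hand because the scalars form a set rather than a
  type. If the last coordinate does not vanish throughout, a pivot clears it from the other vectors,
  and the pivot vector is dropped together with that coordinate.\<close>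

lemma linear_dependence:
  fixes v :: "'b \<Rightarrow> nat \<Rightarrow> 'a"
  assumes "finite I" "n < card I" "\<And>i j. i \<in> I \<Longrightarrow> v i j \<in> L"
  shows "\<exists>c. (\<forall>i. c i \<in> L) \<and> (\<exists>i\<in>I. c i \<noteq> 0) \<and> (\<forall>j<n. (\<Sum>i\<in>I. c i * v i j) = 0)"
  using assms
proof (induction n arbitrary: I v)
  case 0
  \<comment> \<open>There are no equations, and \<open>I\<close> is nonempty because
    \<open>0 < card I\<close>, so any nonzero coefficients in \<open>L\<close> serve.\<close>
  then show ?case
    by (intro exI[of _ "\<lambda>_. 1"]) (auto simp: subfield_1[OF L] card_gt_0_iff)
next
  case (Suc n)
  show ?case
  proof (cases "\<forall>i\<in>I. v i n = 0")
    case True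
    obtain c where c: "\<forall>i. c i \<in> L" "\<exists>i\<in>I. c i \<noteq> 0" "\<forall>j<n. (\<Sum>i\<in>I. c i * v i j) = 0"
      using Suc.IH[of I v] Suc.prems by auto
    moreover have "(\<Sum>i\<in>I. c i * v i n) = 0"
      using True by simp
    ultimately show ?thesis
      by (intro exI[of _ c]) (auto simp: less_Suc_eq)
  next
    case False
    then obtain k where k: "k \<in> I" "v k n \<noteq> 0" by blast
    \<comment> \<open>The multiple of vector \<open>k\<close> subtracted here makes coordinate
      \<open>n\<close> zero.\<close>
    define v' where "v' i j = v i j - v i n / v k n * v k j" for i j
    have "v' i j \<in> L" if "i \<in> I" for i j
      unfolding v'_def using that k Suc.prems(3)
      by (intro subfield_diff[OF L] subfield_mult[OF L] subfield_divide[OF L]) auto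
    moreover have card_I: "n < card (I - {k})"
      using Suc.prems(2) k(1) by (simp add: card_Diff_singleton)
    ultimately obtain c where c: "\<forall>i. c i \<in> L" "\<exists>i\<in>I - {k}. c i \<noteq> 0"
      "\<forall>j<n. (\<Sum>i\<in>I - {k}. c i * v' i j) = 0"
      using Suc.IH[of "I - {k}" v'] Suc.prems(1) card_I by auto
    \<comment> \<open>The coefficient of the pivot collects the multiples subtracted in
      \<open>v'\<close>, so the combination of the \<open>v\<close> with \<open>c'\<close> equals
      that of the \<open>v'\<close> with \<open>c\<close>.\<close>
    define c' where "c' = c(k := - (\<Sum>i\<in>I - {k}. c i * v i n) / v k n)"
    have "c' k \<in> L"
      unfolding c'_def using c(1) Suc.prems(3) k(1)
      by (auto intro!: subfield_divide[OF L] subfield_minus[OF L] subfield_sum[OF L] subfield_mult[OF L])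
    then have "\<forall>i. c' i \<in> L"
      using c(1) by (simp add: c'_def)
    moreover have "\<exists>i\<in>I. c' i \<noteq> 0"
      using c(2) by (auto simp: c'_def)
    moreover have "(\<Sum>i\<in>I. c' i * v i j) = 0" if "j < Suc n" for j
    proof -
      have "(\<Sum>i\<in>I. c' i * v i j) = c' k * v k j + (\<Sum>i\<in>I - {k}. c i * v i j)"
        using Suc.prems(1) k(1) by (subst sum.remove[of _ k]) (auto simp: c'_def)
      also have "\<dots> = (\<Sum>i\<in>I - {k}. c i * v' i j)"
        by (simp add: c'_def v'_def sum_subtractf right_diff_distrib sum_distrib_right sum_divide_distrib mult.assoc)
      also have "\<dots> = 0"
        using c(3) that k(2) by (cases "j = n") (auto simp: v'_def)
      finally show ?thesis .
    qed
    ultimately show ?thesis by blast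
  qed
qed

text \<open>Division by a monic \<open>g\<close> of degree \<open>n\<close> annihilating
  \<open>x\<close> puts every power of \<open>y = poly h x\<close> into the span of the first
  \<open>n\<close> powers of \<open>x\<close>. The \<open>n + 1\<close> powers of \<open>y\<close>
  up to exponent \<open>n\<close> are therefore dependent over \<open>L\<close>.\<close>

lemma algebraic_over_poly:
  assumes x: "algebraic_over L x" and h: "h \<in> polys_over L"
  shows "algebraic_over L (poly h x)"
proof -
  obtain g where g: "g \<in> polys_over L" "lead_coeff g = 1" "poly g x = 0"
    using minimal_polynomial[OF x] by metis
  define n where "n = degree g"
  define y where "y = poly h x"
  have "\<exists>s\<in>polys_over L. y ^ i = (\<Sum>j<n. coeff s j * x ^ j)" for i
  proof -
    have "h ^ i \<in> polys_over L"
      by (induction i) (auto simp: h polys_over_mult polys_over_monom[of 1 0, simplified] subfield_1[OF L])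
    then obtain q s where s: "s \<in> polys_over L" "h ^ i = g * q + s" "s = 0 \<or> degree s < n"
      using polys_over_division[OF g(1,2)] n_def by metis
    have "y ^ i = poly s x"
      using g(3) s(2) by (metis y_def poly_power poly_add poly_mult mult_zero_left add_0)
    also have "\<dots> = (\<Sum>j<n. coeff s j * x ^ j)"
    proof (cases "s = 0")
      case False
      then show ?thesis
        using s(3) unfolding poly_altdef
        by (intro sum.mono_neutral_left) (auto simp: coeff_eq_0)
    qed simp
    finally show ?thesis using s(1) by blast
  qed
  then obtain s where s: "\<And>i. s i \<in> polys_over L" "\<And>i. y ^ i = (\<Sum>j<n. coeff (s i) j * x ^ j)"
    by metis
  obtain c where c: "\<forall>i. c i \<in> L" "\<exists>i\<in>{..n}. c i \<noteq> 0"
    "\<forall>j<n. (\<Sum>i\<le>n. c i * coeff (s i) j) = 0"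
    using linear_dependence[of "{..n}" n "\<lambda>i. coeff (s i)"] s(1) by (auto simp: polys_over_def)
  define f where "f = (\<Sum>i\<le>n. monom (c i) i)"
  have coeff_f: "coeff f k = (if k \<le> n then c k else 0)" for k
    by (simp add: f_def coeff_sum)
  have "poly f y = (\<Sum>i\<le>n. c i * (\<Sum>j<n. coeff (s i) j * x ^ j))"
    by (simp add: f_def poly_sum poly_monom s(2))
  also have "\<dots> = (\<Sum>j<n. (\<Sum>i\<le>n. c i * coeff (s i) j) * x ^ j)"
    unfolding sum_distrib_left sum_distrib_right by (subst sum.swap) (simp add: mult.assoc)
  also have "\<dots> = 0" using c(3) by simp
  finally have "poly f y = 0" .
  moreover have "f \<noteq> 0"
    using c(2) coeff_f by (metis atMost_iff coeff_0)
  moreover have "\<forall>k. coeff f k \<in> L"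
    using c(1) by (simp add: coeff_f subfield_0[OF L])
  ultimately show ?thesis
    unfolding algebraic_over_def y_def by blast
qed

text \<open>Only inverses need an argument. A nonzero value \<open>y\<close> is itself algebraic,
  and its minimal polynomial has a nonzero constant term; solving for that term writes
  \<open>inverse y\<close> as a polynomial in \<open>y\<close>, hence in \<open>x\<close>.\<close>

lemma adjoin_algebraic:
  assumes x: "algebraic_over L x"
  shows "adjoin L {x} = {poly h x | h. h \<in> polys_over L}" (is "_ = ?R")
proof
  have I: "poly h x \<in> ?R" if "h \<in> polys_over L" for h
    using that by blast
  have inv: "inverse y \<in> ?R" if y: "y \<in> ?R" for y
  proof (cases "y = 0")
    case True
    then show ?thesis using that by simp
  next
    case False
    obtain h where h: "h \<in> polys_over L" "y = poly h x" using y by blast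
    obtain g where g: "g \<in> polys_over L" "lead_coeff g = 1" "poly g y = 0"
      and min: "\<And>f. f \<in> polys_over L \<Longrightarrow> poly f y = 0 \<Longrightarrow> f = 0 \<or> degree g \<le> degree f"
      using minimal_polynomial[OF algebraic_over_poly[OF x h(1)]] h(2) by metis
    obtain a f where gf: "g = pCons a f" by (cases g)
    have f: "f \<in> polys_over L" "a \<in> L"
      using g(1) by (simp_all add: gf polys_over_pCons)
    have fy: "a + y * poly f y = 0"
      using g(3) by (simp add: gf)
    \<comment> \<open>With zero constant term, dividing by \<open>y\<close> would leave an
      annihilating polynomial of smaller degree.\<close>
    have "a \<noteq> 0"
    proof
      assume "a = 0"
      then have "poly f y = 0" "f \<noteq> 0" using fy False g(2) gf by auto
      then show False using min[OF f(1)] by (simp add: gf)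
    qed
    have "inverse y = poly f y * (- inverse a)"
      using fy \<open>a \<noteq> 0\<close> False by (simp add: field_simps add_eq_0_iff)
    also have "\<dots> = poly (smult (- inverse a) (pcompose f h)) x"
      by (simp add: poly_pcompose h(2))
    also have "\<dots> \<in> ?R"
    proof -
      have "pcompose f h \<in> polys_over L" using f(1)
        by (induction f) (auto simp: pcompose_pCons polys_over_pCons polys_over_0 h
            intro!: polys_over_add polys_over_mult)
      then show ?thesis
        using f(2) by (intro I polys_over_smult subfield_minus[OF L] subfield_inverse[OF L])
    qed
    finally show ?thesis .
  qed
  have const: "c \<in> ?R" if "c \<in> L" for c
    using I[of "[:c:]"] that by (simp add: polys_over_pCons polys_over_0)
  have "is_subfield ?R"
    unfolding is_subfield_def
  proof (intro conjI ballI)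
    show "0 \<in> ?R" "1 \<in> ?R" by (rule const[OF subfield_0[OF L]], rule const[OF subfield_1[OF L]])
    fix y assume y: "y \<in> ?R"
    then obtain h where h: "h \<in> polys_over L" "y = poly h x" by blast
    show "inverse y \<in> ?R" by (rule inv[OF y])
    show "- y \<in> ?R" using I[OF polys_over_minus[OF h(1)]] h(2) by simp
    fix z assume "z \<in> ?R"
    then obtain h' where h': "h' \<in> polys_over L" "z = poly h' x" by blast
    show "y + z \<in> ?R" "y * z \<in> ?R"
      using I[OF polys_over_add[OF h(1) h'(1)]] I[OF polys_over_mult[OF h(1) h'(1)]]
      by (simp_all add: h(2) h'(2))
  qed
  moreover have "x \<in> ?R"
    using I[of "[:0, 1:]"] by (simp add: polys_over_pCons polys_over_0 subfield_0[OF L] subfield_1[OF L])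
  ultimately show "adjoin L {x} \<subseteq> ?R"
    using const by (intro adjoin_least) auto
  show "?R \<subseteq> adjoin L {x}"
  proof clarify
    fix h assume "h \<in> polys_over L"
    then have "h \<in> polys_over (adjoin L {x})"
      using polys_over_mono[OF adjoin_superset] by blast
    moreover have "x \<in> adjoin L {x}" using generators_adjoin by blast
    ultimately show "poly h x \<in> adjoin L {x}"
      by (intro poly_in_subfield subfield_adjoin)
  qed
qed

end

section \<open>Constants of algebraic extensions\<close>

lemma algebraic_over_algebraically_closed:
  assumes C: "is_subfield C" "algebraically_closed C" and x: "algebraic_over C x"
  shows "x \<in> C"
proof -
  obtain g where g: "g \<in> polys_over C" "lead_coeff g = 1" "poly g x = 0"
    and min: "\<And>f. f \<in> polys_over C \<Longrightarrow> poly f x = 0 \<Longrightarrow> f = 0 \<or> degree g \<le> degree f"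
    using minimal_polynomial[OF C(1) x] by metis
  have deg: "degree g > 0"
  proof (rule ccontr)
    assume "\<not> ?thesis"
    then obtain c where "g = [:c:]" by (auto elim: degree_eq_zeroE)
    then show False using g(2,3) by simp
  qed
  then obtain a where a: "a \<in> C" "poly g a = 0"
    using C(2) g(1) unfolding algebraically_closed_def polys_over_def by blast
  \<comment> \<open>The root \<open>a\<close> in \<open>C\<close> splits a linear factor off the
    minimal polynomial. The cofactor has smaller degree and cannot vanish at \<open>x\<close>, so
    the linear factor does, which gives \<open>x = a\<close>.\<close>
  have "[:-a, 1:] \<in> polys_over C"
    using a(1) by (simp add: polys_over_pCons[OF C(1)] polys_over_0[OF C(1)] subfield_1[OF C(1)]
        subfield_minus[OF C(1)])
  then obtain q s where q: "q \<in> polys_over C" "s \<in> polys_over C" and s: "g = [:-a, 1:] * q + s"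
    "s = 0 \<or> degree s < degree [:-a, 1:]"
    by (rule polys_over_division[OF C(1) _ _ g(1), of "[:-a, 1:]"]) simp
  have "poly s a = 0" using a(2) s(1) by simp
  then have "s = 0"
    using s(2) by (auto elim: degree_eq_zeroE)
  then have gq: "g = [:-a, 1:] * q" using s(1) by simp
  have "q \<noteq> 0" using gq deg by auto
  then have "degree g = Suc (degree q)"
    unfolding gq by (subst degree_mult_eq) auto
  then have "poly q x \<noteq> 0" using min[OF q(1)] \<open>q \<noteq> 0\<close> by auto
  then have "x = a" using g(3) unfolding gq by simp
  then show ?thesis using a(1) by simp
qed

text \<open>The product rule at a constant point produces no derivative of the argument, so
  \<open>D\<close> acts on the coefficients alone.\<close>

lemma derivation_poly_constant:
  assumes D: "derivation D" and c: "D c = 0"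
  shows "D (poly f c) = poly (map_poly D f) c"
  by (induction f) (simp_all add: map_poly_pCons derivation_0[OF D] derivation_add[OF D]
      derivation_mult[OF D] c)

text \<open>Applying \<open>D\<close> to the coefficients of the minimal polynomial of a constant
  \<open>c\<close> kills the leading coefficient \<open>1\<close> and keeps \<open>c\<close> as a
  root. Minimality makes the result zero, so \<open>c\<close> is algebraic over the constants of
  \<open>L\<close>, and these are algebraically closed.\<close>

lemma constants_adjoin_algebraic:
  fixes L :: "'a::field set"
  assumes D: "derivation D" and L: "diff_subfield D L"
    and C: "algebraically_closed (constants D L)" and x: "algebraic_over L x"
  shows "constants D (adjoin L {x}) = constants D L"
proof
  have sub: "is_subfield L" using L by (simp add: diff_subfield_def)
  show "constants D L \<subseteq> constants D (adjoin L {x})"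
    using adjoin_superset by (auto simp: constants_def)
  show "constants D (adjoin L {x}) \<subseteq> constants D L"
  proof
    fix c assume "c \<in> constants D (adjoin L {x})"
    then obtain h where h: "h \<in> polys_over L" "c = poly h x" and c: "D c = 0"
      unfolding adjoin_algebraic[OF sub x] constants_def by blast
    obtain g where g: "g \<in> polys_over L" "lead_coeff g = 1" "poly g c = 0"
      and min: "\<And>f. f \<in> polys_over L \<Longrightarrow> poly f c = 0 \<Longrightarrow> f = 0 \<or> degree g \<le> degree f"
      using minimal_polynomial[OF sub algebraic_over_poly[OF sub x h(1)]] h(2) by metis
    let ?g' = "map_poly D g"
    have coeff_g': "coeff ?g' k = D (coeff g k)" for k
      by (simp add: coeff_map_poly derivation_0[OF D])
    have "?g' \<in> polys_over L"
      using g(1) L by (auto simp: polys_over_def coeff_g' diff_subfield_def)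
    moreover have "poly ?g' c = 0"
      using derivation_poly_constant[OF D c, of g] g(3) derivation_0[OF D] by simp
    ultimately have "?g' = 0 \<or> degree g \<le> degree ?g'" by (rule min)
    moreover have "coeff ?g' (degree g) = 0"
      using g(2) derivation_1[OF D] by (simp add: coeff_g')
    moreover have "degree ?g' \<le> degree g"
      by (rule degree_le) (simp add: coeff_g' coeff_eq_0 derivation_0[OF D])
    ultimately have "?g' = 0"
      by (metis le_antisym leading_coeff_0_iff)
    then have "D (coeff g k) = 0" for k
      using coeff_g'[of k] by simp
    then have "algebraic_over (constants D L) c"
      unfolding algebraic_over_def using g
      by (intro exI[of _ g]) (auto simp: constants_def polys_over_def)
    then show "c \<in> constants D L"
      using algebraic_over_algebraically_closed[OF subfield_constants[OF D sub] C] by blast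
  qed
qed

text \<open>An irreducible factor \<open>h0\<close> is split off as \<open>f = h0 * f'\<close>. By
  primality a monic divisor of \<open>f\<close> either contains \<open>h0\<close> and leaves a
  divisor of \<open>f'\<close>, or divides \<open>f'\<close> itself, and \<open>f'\<close> has
  smaller degree.\<close>

lemma finite_monic_divisors:
  fixes f :: "'a::field poly"
  assumes "f \<noteq> 0"
  shows "finite {d. d dvd f \<and> lead_coeff d = 1}"
  using assms
proof (induction "degree f" arbitrary: f rule: less_induct)
  case less
  show ?case
  proof (cases "degree f = 0")
    case True
    have "d = 1" if "d dvd f" "lead_coeff d = 1" for d
    proof -
      have "degree d = 0" using dvd_imp_degree_le[OF that(1) less.prems] True by simp
      then show ?thesis using that(2) by (metis degree_0_id of_nat_1 one_pCons)
    qed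
    then have "{d. d dvd f \<and> lead_coeff d = 1} \<subseteq> {1}" by blast
    then show ?thesis by (rule finite_subset) simp
  next
    case False
    \<comment> \<open>A nonconstant divisor of least degree has no proper factorisation, so it is
      irreducible.\<close>
    define P where "P h \<longleftrightarrow> h dvd f \<and> degree h > 0" for h
    have "P f" using False by (simp add: P_def)
    then obtain h0 where h0: "P h0" and min: "\<And>h. P h \<Longrightarrow> degree h0 \<le> degree h"
      using ex_has_least_nat[of P f degree] by auto
    have "h0 \<noteq> 0" using h0 by (auto simp: P_def)
    have "irreducible h0"
    proof (rule irreducibleI)
      show "h0 \<noteq> 0" by fact
      show "\<not> is_unit h0" using h0 by (auto simp: P_def is_unit_iff_degree[OF \<open>h0 \<noteq> 0\<close>])
      fix a b assume ab: "h0 = a * b"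
      have "a \<noteq> 0" "b \<noteq> 0" using ab \<open>h0 \<noteq> 0\<close> by auto
      have "degree h0 = degree a + degree b"
        unfolding ab using \<open>a \<noteq> 0\<close> \<open>b \<noteq> 0\<close> by (rule degree_mult_eq)
      moreover have "a dvd f" "b dvd f"
        using h0 by (auto simp: P_def ab intro: dvd_mult_left dvd_mult_right)
      ultimately have "degree a = 0 \<or> degree b = 0"
        using min[of a] min[of b] by (fastforce simp: P_def)
      then show "is_unit a \<or> is_unit b"
        by (simp add: is_unit_iff_degree \<open>a \<noteq> 0\<close> \<open>b \<noteq> 0\<close>)
    qed
    then have prime: "prime_elem h0" by (rule field_poly_irreducible_imp_prime)
    \<comment> \<open>The factor \<open>h0\<close> need not be monic; its leading coefficient
      \<open>c\<close> is moved to the cofactor, which becomes monic.\<close>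
    define c where "c = lead_coeff h0"
    have "c \<noteq> 0" using \<open>h0 \<noteq> 0\<close> by (simp add: c_def)
    obtain f' where f': "f = h0 * f'" using h0 by (auto simp: P_def)
    have "f' \<noteq> 0" using f' less.prems by auto
    have "degree f = degree h0 + degree f'"
      unfolding f' using \<open>h0 \<noteq> 0\<close> \<open>f' \<noteq> 0\<close> by (rule degree_mult_eq)
    then have "degree f' < degree f" using h0 by (simp add: P_def)
    then have fin: "finite {d. d dvd f' \<and> lead_coeff d = 1}"
      using less.hyps[OF _ \<open>f' \<noteq> 0\<close>] by blast
    let ?S = "{d. d dvd f' \<and> lead_coeff d = 1}"
    have "d \<in> ?S \<union> (\<lambda>e. smult (inverse c) (h0 * e)) ` ?S"
      if d: "d dvd f" "lead_coeff d = 1" for d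
    proof -
      obtain e where e: "h0 * f' = d * e" using d(1) f' by auto
      then have "h0 dvd d * e" by (metis dvd_triv_left)
      then consider "h0 dvd d" | "h0 dvd e" using prime prime_elem_dvd_mult_iff by blast
      then show ?thesis
      proof cases
        case 1
        then obtain d' where d': "d = h0 * d'" by blast
        then have "f' = d' * e" using e \<open>h0 \<noteq> 0\<close> by (simp add: mult.assoc)
        then have "smult c d' dvd f'" using \<open>c \<noteq> 0\<close> by (simp add: smult_dvd)
        moreover have "lead_coeff (smult c d') = 1"
          using d(2) unfolding d' by (simp add: lead_coeff_mult c_def \<open>h0 \<noteq> 0\<close>)
        moreover have "d = smult (inverse c) (h0 * smult c d')"
          using \<open>c \<noteq> 0\<close> by (simp add: d')
        ultimately show ?thesis by blast
      next
        case 2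
        then obtain e' where "e = h0 * e'" by blast
        then have "f' = d * e'" using e \<open>h0 \<noteq> 0\<close> by (simp add: mult.left_commute)
        then show ?thesis using d(2) by simp
      qed
    qed
    then have "{d. d dvd f \<and> lead_coeff d = 1} \<subseteq> ?S \<union> (\<lambda>e. smult (inverse c) (h0 * e)) ` ?S"
      by blast
    then show ?thesis using fin by (auto intro: finite_subset)
  qed
qed

section \<open>Zero sets in the Zariski topology\<close>

lemma matrix_polys_in: "f \<in> matrix_polys C \<Longrightarrow> is_subfield C \<Longrightarrow> entries M \<subseteq> C \<Longrightarrow> f M \<in> C"
  by (induction rule: matrix_polys.induct) (auto simp: entries_subset_iff subfield_closed)

lemma matrix_polys_sum:
  assumes "0 \<in> C" "\<And>i. i \<in> I \<Longrightarrow> f i \<in> matrix_polys C"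
  shows "(\<lambda>M. \<Sum>i\<in>I. f i M) \<in> matrix_polys C"
  using assms
  by (induction I rule: infinite_finite_induct) (auto intro: matrix_polys.intros)

text \<open>Each entry of \<open>Z ** M\<close> is a linear form in the entries of \<open>M\<close>
  whose coefficients come from \<open>Z\<close> and are arbitrary; hence \<open>UNIV\<close> in the
  conclusion.\<close>

lemma matrix_polys_compose_mult:
  "f \<in> matrix_polys K \<Longrightarrow> (\<lambda>M. f (Z ** M)) \<in> matrix_polys UNIV"
  by (induction rule: matrix_polys.induct)
     (auto simp: matrix_mult_nth intro!: matrix_polys_sum matrix_polys.intros)

text \<open>Constants and matrix entries split into a scalar and a polynomial over \<open>C\<close>.
  A list of such pairs lets sums be concatenated and products multiplied out without collecting
  terms.\<close>

lemma matrix_polys_expansion: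
  assumes "f \<in> matrix_polys UNIV" "1 \<in> C"
  shows "\<exists>xs. snd ` set xs \<subseteq> matrix_polys C \<and> f = (\<lambda>M. \<Sum>(a, g)\<leftarrow>xs. a * g M)"
  using assms
proof (induction rule: matrix_polys.induct)
  case (const c)
  then show ?case
    by (intro exI[of _ "[(c, \<lambda>M. 1)]"]) (auto intro: matrix_polys.intros)
next
  case (entry i j)
  show ?case
    by (intro exI[of _ "[(1, \<lambda>M. M $ i $ j)]"]) (auto intro: matrix_polys.intros)
next
  case (add f g)
  then obtain xs ys where "snd ` set xs \<subseteq> matrix_polys C" "f = (\<lambda>M. \<Sum>(a, g)\<leftarrow>xs. a * g M)"
    "snd ` set ys \<subseteq> matrix_polys C" "g = (\<lambda>M. \<Sum>(a, g)\<leftarrow>ys. a * g M)" by blast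
  then show ?case by (intro exI[of _ "xs @ ys"]) auto
next
  case (mult f g)
  then obtain xs ys where xs: "snd ` set xs \<subseteq> matrix_polys C" "f = (\<lambda>M. \<Sum>(a, g)\<leftarrow>xs. a * g M)"
    and ys: "snd ` set ys \<subseteq> matrix_polys C" "g = (\<lambda>M. \<Sum>(a, g)\<leftarrow>ys. a * g M)" by blast
  have "\<exists>zs. snd ` set zs \<subseteq> matrix_polys C \<and>
    (\<forall>M. (\<Sum>(a, g)\<leftarrow>xs. a * g M) * g M = (\<Sum>(a, g)\<leftarrow>zs. a * g M))"
    using xs(1)
  proof (induction xs)
    case Nil
    show ?case by (intro exI[of _ "[]"]) simp
  next
    case (Cons x xs)
    obtain a h where x: "x = (a, h)" by (cases x)
    have h: "h \<in> matrix_polys C" using Cons.prems by (simp add: x)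
    obtain zs where zs: "snd ` set zs \<subseteq> matrix_polys C"
      "\<And>M. (\<Sum>(a, g)\<leftarrow>xs. a * g M) * g M = (\<Sum>(a, g)\<leftarrow>zs. a * g M)"
      using Cons by auto
    let ?ys = "map (\<lambda>(b, k). (a * b, \<lambda>M. h M * k M)) ys"
    have "snd ` set ?ys \<subseteq> matrix_polys C"
      using ys(1) h by (force intro: matrix_polys.mult)
    moreover have "a * h M * (\<Sum>(b, k)\<leftarrow>ys. b * k M) = (\<Sum>(b, k)\<leftarrow>?ys. b * k M)" for M
      by (induction ys) (auto simp: algebra_simps)
    ultimately show ?case
      using zs by (intro exI[of _ "?ys @ zs"] conjI) (auto simp: x ys(2) distrib_right image_Un)
  qed
  then show ?case using xs(2) by (auto simp: fun_eq_iff)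
qed

text \<open>The scalars of an expansion are thinned out, one at a time, to a family \<open>B\<close>
  independent over \<open>C\<close>, at the cost of changing the accompanying polynomials.\<close>

lemma matrix_polys_independent_expansion:
  fixes C :: "'a::field set" and f :: "'a^'n^'n \<Rightarrow> 'a"
  assumes C: "is_subfield C" and f: "f \<in> matrix_polys UNIV"
  obtains B F where "finite B" "\<forall>b. F b \<in> matrix_polys C" "\<forall>M. f M = (\<Sum>b\<in>B. F b M * b)"
    "\<forall>c. (\<forall>b\<in>B. c b \<in> C) \<and> (\<Sum>b\<in>B. c b * b) = 0 \<longrightarrow> (\<forall>b\<in>B. c b = 0)"
proof -
  obtain xs where xs: "snd ` set xs \<subseteq> matrix_polys C" "f = (\<lambda>M. \<Sum>(a, g)\<leftarrow>xs. a * g M)"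
    using matrix_polys_expansion[OF f subfield_1[OF C]] by blast
  have "\<exists>B F. finite B \<and> (\<forall>b. F b \<in> matrix_polys C) \<and>
    (\<forall>M. (\<Sum>(a, g)\<leftarrow>xs. a * g M) = (\<Sum>b\<in>B. F b M * b)) \<and>
    (\<forall>c. (\<forall>b\<in>B. c b \<in> C) \<and> (\<Sum>b\<in>B. c b * b) = 0 \<longrightarrow> (\<forall>b\<in>B. c b = 0))"
    using xs(1)
  proof (induction xs)
    case Nil
    show ?case
      by (intro exI[of _ "{}"] exI[of _ "\<lambda>_ _. 0"])
         (auto intro: matrix_polys.const subfield_0[OF C])
  next
    case (Cons x xs)
    obtain a h where x: "x = (a, h)" by (cases x)
    have h: "h \<in> matrix_polys C" using Cons.prems by (simp add: x)
    have "snd ` set xs \<subseteq> matrix_polys C" using Cons.prems by simp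
    from Cons.IH[OF this] obtain B F where B: "finite B" "\<forall>b. F b \<in> matrix_polys C"
      "\<forall>M. (\<Sum>(a, g)\<leftarrow>xs. a * g M) = (\<Sum>b\<in>B. F b M * b)"
      and ind: "\<forall>c. (\<forall>b\<in>B. c b \<in> C) \<and> (\<Sum>b\<in>B. c b * b) = 0 \<longrightarrow> (\<forall>b\<in>B. c b = 0)"
      by (elim exE conjE)
    have sum_Cons: "(\<Sum>(a, g)\<leftarrow>x # xs. a * g M) = a * h M + (\<Sum>b\<in>B. F b M * b)" for M
      by (simp add: x B(3))
    show ?case
    \<comment> \<open>A scalar \<open>a\<close> in the span of \<open>B\<close> is absorbed:
      multiples of its polynomial \<open>h\<close> are added to the polynomials of \<open>B\<close>.
      Otherwise \<open>a\<close> joins \<open>B\<close>, with \<open>h\<close> as its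
      polynomial.\<close>
    proof (cases "\<exists>c. (\<forall>b. c b \<in> C) \<and> a = (\<Sum>b\<in>B. c b * b)")
      case True
      then obtain c where c: "\<And>b. c b \<in> C" "a = (\<Sum>b\<in>B. c b * b)" by blast
      let ?F = "\<lambda>b M. F b M + c b * h M"
      have "\<forall>b. ?F b \<in> matrix_polys C"
        using B(2) h c(1) by (intro allI matrix_polys.intros) simp_all
      moreover have "\<forall>M. (\<Sum>(a, g)\<leftarrow>x # xs. a * g M) = (\<Sum>b\<in>B. ?F b M * b)"
        unfolding sum_Cons c(2) by (simp add: algebra_simps sum.distrib sum_distrib_left)
      ultimately show ?thesis
        using B(1) ind by (intro exI[of _ B] exI[of _ ?F] conjI)
    next
      case False
      have "a \<notin> B"
      proof
        assume "a \<in> B"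
        then have "a = (\<Sum>b\<in>B. (if b = a then 1 else 0) * b)"
          using B(1) by (simp add: if_distribR sum.delta flip: of_bool_def)
        moreover have "\<forall>b. (if b = a then 1 else 0) \<in> C"
          using subfield_0[OF C] subfield_1[OF C] by simp
        ultimately have "\<exists>c. (\<forall>b. c b \<in> C) \<and> a = (\<Sum>b\<in>B. c b * b)"
          by (intro exI[of _ "\<lambda>b. if b = a then 1 else 0"] conjI)
        with False show False by contradiction
      qed
      let ?F = "F(a := h)"
      have "\<forall>b. ?F b \<in> matrix_polys C"
        using B(2) h by simp
      moreover have "\<forall>M. (\<Sum>(a, g)\<leftarrow>x # xs. a * g M) = (\<Sum>b\<in>insert a B. ?F b M * b)"
      proof
        fix M
        have "(\<Sum>b\<in>B. ?F b M * b) = (\<Sum>b\<in>B. F b M * b)"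
          using \<open>a \<notin> B\<close> by (intro sum.cong) auto
        then show "(\<Sum>(a, g)\<leftarrow>x # xs. a * g M) = (\<Sum>b\<in>insert a B. ?F b M * b)"
          unfolding sum_Cons using B(1) \<open>a \<notin> B\<close> by (simp add: mult.commute)
      qed
      moreover have "\<forall>c. (\<forall>b\<in>insert a B. c b \<in> C) \<and> (\<Sum>b\<in>insert a B. c b * b) = 0
          \<longrightarrow> (\<forall>b\<in>insert a B. c b = 0)"
      proof (intro allI impI, elim conjE)
        fix c assume c: "\<forall>b\<in>insert a B. c b \<in> C" "(\<Sum>b\<in>insert a B. c b * b) = 0"
        have sum0: "c a * a + (\<Sum>b\<in>B. c b * b) = 0"
          using c(2) B(1) \<open>a \<notin> B\<close> by simp
        \<comment> \<open>A relation with nonzero coefficient at \<open>a\<close> could be solved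
          for \<open>a\<close>, which would place it in the span of \<open>B\<close>.\<close>
        have "c a = 0"
        proof (rule ccontr)
          assume nz: "c a \<noteq> 0"
          have "a = (\<Sum>b\<in>B. (if b \<in> B then - (c b / c a) else 0) * b)"
          proof -
            have "a = - (\<Sum>b\<in>B. c b * b) / c a"
              using sum0 nz by (simp add: field_simps add_eq_0_iff)
            also have "\<dots> = (\<Sum>b\<in>B. (if b \<in> B then - (c b / c a) else 0) * b)"
              by (simp add: sum_negf sum_divide_distrib cong: sum.cong)
            finally show ?thesis .
          qed
          moreover have "\<forall>b. (if b \<in> B then - (c b / c a) else 0) \<in> C"
            using c(1) by (auto intro!: subfield_0[OF C] subfield_minus[OF C] subfield_divide[OF C])
          ultimately have "\<exists>c. (\<forall>b. c b \<in> C) \<and> a = (\<Sum>b\<in>B. c b * b)"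
            by (intro exI[of _ "\<lambda>b. if b \<in> B then - (c b / c a) else 0"] conjI)
          with False show False by contradiction
        qed
        then show "\<forall>b\<in>insert a B. c b = 0"
          using sum0 ind c(1) by simp
      qed
      moreover have "finite (insert a B)" using B(1) by simp
      ultimately show ?thesis
        by (intro exI[of _ "insert a B"] exI[of _ ?F] conjI)
    qed
  qed
  then obtain B F where "finite B" and F: "\<forall>b. F b \<in> matrix_polys C"
    "\<forall>M. (\<Sum>(a, g)\<leftarrow>xs. a * g M) = (\<Sum>b\<in>B. F b M * b)"
    and ind: "\<forall>c. (\<forall>b\<in>B. c b \<in> C) \<and> (\<Sum>b\<in>B. c b * b) = 0 \<longrightarrow> (\<forall>b\<in>B. c b = 0)"
    by (elim exE conjE)
  show ?thesis
  proof (rule that[of B F])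
    show "\<forall>M. f M = (\<Sum>b\<in>B. F b M * b)"
      unfolding xs(2) by (rule F(2))
  qed (use \<open>finite B\<close> F(1) ind in simp_all)
qed

text \<open>Expanding the coefficients along elements that are linearly independent over \<open>C\<close>
  turns an equation with arbitrary coefficients into equations over \<open>C\<close>.\<close>

lemma closedin_zariski_zero_set:
  fixes C :: "'a::field set" and f :: "'a^'n^'n \<Rightarrow> 'a"
  assumes C: "is_subfield C" and f: "f \<in> matrix_polys UNIV"
  shows "closedin (zariski C) {M. entries M \<subseteq> C \<and> f M = 0}"
proof -
  obtain B F where B: "finite B" "\<forall>b. F b \<in> matrix_polys C" "\<forall>M. f M = (\<Sum>b\<in>B. F b M * b)"
    and ind: "\<forall>c. (\<forall>b\<in>B. c b \<in> C) \<and> (\<Sum>b\<in>B. c b * b) = 0 \<longrightarrow> (\<forall>b\<in>B. c b = 0)"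
    by (rule matrix_polys_independent_expansion[OF C f])
  have "f M \<noteq> 0 \<longleftrightarrow> (\<exists>g\<in>F ` B. g M \<noteq> 0)" if "entries M \<subseteq> C" for M
  proof -
    have "f M = 0 \<longleftrightarrow> (\<forall>b\<in>B. F b M = 0)"
      using ind[rule_format, of "\<lambda>b. F b M"] matrix_polys_in[OF B(2)[rule_format] C that] B(3) by auto
    then show ?thesis by blast
  qed
  then have "{M. entries M \<subseteq> C \<and> f M \<noteq> 0} = {M. entries M \<subseteq> C \<and> (\<exists>g\<in>F ` B. g M \<noteq> 0)}"
    by (intro Collect_cong conj_cong refl)
  moreover have "F ` B \<subseteq> matrix_polys C" using B(2) by (simp add: image_subset_iff)
  ultimately have "zariski_open C {M. entries M \<subseteq> C \<and> f M \<noteq> 0}"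
    unfolding zariski_open_def by (intro exI[of _ "F ` B"] conjI)
  moreover have "topspace (zariski C) - {M. entries M \<subseteq> C \<and> f M = 0}
    = {M. entries M \<subseteq> C \<and> f M \<noteq> 0}"
    unfolding topspace_zariski[OF subfield_1[OF C]] set_diff_eq mem_Collect_eq by (rule Collect_cong) argo
  moreover have "{M. entries M \<subseteq> C \<and> f M = 0} \<subseteq> topspace (zariski C)"
    by (simp add: topspace_zariski[OF subfield_1[OF C]] subset_iff)
  ultimately show ?thesis
    by (simp add: closedin_def openin_zariski)
qed


section \<open>Homomorphisms on a subfield\<close>

text \<open>The laws hold only on \<open>L\<close>, while \<open>\<sigma>\<close> is total on the
  ambient type and may leave \<open>L\<close>; automorphisms of \<open>K(Z)\<close> and of its
  extensions are instances.\<close>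

locale subfield_hom =
  fixes L :: "'a::field set" and \<sigma> :: "'a \<Rightarrow> 'a"
  assumes subfield: "is_subfield L"
    and add: "x \<in> L \<Longrightarrow> y \<in> L \<Longrightarrow> \<sigma> (x + y) = \<sigma> x + \<sigma> y"
    and mult: "x \<in> L \<Longrightarrow> y \<in> L \<Longrightarrow> \<sigma> (x * y) = \<sigma> x * \<sigma> y"
    and one: "\<sigma> 1 = 1"
begin

lemmas closed = subfield_closed[OF subfield]

lemma zero: "\<sigma> 0 = 0"
  using add[OF closed(1) closed(1)] by (metis add_0 add_cancel_right_right)

lemma minus: "x \<in> L \<Longrightarrow> \<sigma> (- x) = - \<sigma> x"
  using add[of x "- x"] closed zero by (simp add: add_eq_0_iff)

lemma eq_0_iff: "x \<in> L \<Longrightarrow> \<sigma> x = 0 \<longleftrightarrow> x = 0"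
  using mult[of x "inverse x"] closed zero one by (metis mult_zero_left right_inverse zero_neq_one)

lemma inverse: "x \<in> L \<Longrightarrow> \<sigma> (inverse x) = inverse (\<sigma> x)"
  using mult[of x "inverse x"] closed zero one
  by (metis inverse_unique inverse_zero right_inverse)

lemma divide: "x \<in> L \<Longrightarrow> y \<in> L \<Longrightarrow> \<sigma> (x / y) = \<sigma> x / \<sigma> y"
  by (simp add: divide_inverse mult closed inverse)

lemma sum: "(\<And>x. x \<in> A \<Longrightarrow> f x \<in> L) \<Longrightarrow> \<sigma> (sum f A) = (\<Sum>x\<in>A. \<sigma> (f x))"
  by (induction A rule: infinite_finite_induct)
     (simp_all add: zero add subfield_sum[OF subfield])

lemma inj_on: "inj_on \<sigma> L"
proof
  fix x y assume xy: "x \<in> L" "y \<in> L" "\<sigma> x = \<sigma> y"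
  then have "\<sigma> (x + - y) = 0" using add[of x "- y"] minus[of y] closed(5)[of y] by simp
  then show "x = y" using eq_0_iff[of "x + - y"] closed(3)[OF xy(1) closed(5)[OF xy(2)]] by simp
qed

lemma map_poly_mult:
  assumes "f \<in> polys_over L" "g \<in> polys_over L"
  shows "map_poly \<sigma> (f * g) = map_poly \<sigma> f * map_poly \<sigma> g"
  using assms
  by (intro poly_eqI) (simp add: coeff_map_poly zero coeff_mult polys_over_def sum mult closed)

lemma map_poly_add:
  "f \<in> polys_over L \<Longrightarrow> g \<in> polys_over L \<Longrightarrow> map_poly \<sigma> (f + g) = map_poly \<sigma> f + map_poly \<sigma> g"
  by (intro poly_eqI) (simp add: coeff_map_poly zero polys_over_def add)

lemma map_matrix_mult:
  "entries A \<subseteq> L \<Longrightarrow> entries B \<subseteq> L \<Longrightarrow> map_matrix \<sigma> (A ** B) = map_matrix \<sigma> A ** map_matrix \<sigma> B"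
  by (simp add: vec_eq_iff matrix_mult_nth entries_subset_iff sum mult closed)

lemma map_matrix_mat_1: "map_matrix \<sigma> (mat 1) = mat 1"
  by (simp add: vec_eq_iff mat_def zero one)

lemma image_subfield:
  assumes "is_subfield F" "F \<subseteq> L"
  shows "is_subfield (\<sigma> ` F)"
  unfolding is_subfield_def
proof (intro conjI ballI)
  note F = subfield_closed[OF assms(1)]
  show "0 \<in> \<sigma> ` F" "1 \<in> \<sigma> ` F" using F(1,2) zero one by (metis image_eqI)+
  fix x assume "x \<in> \<sigma> ` F"
  then obtain a where a: "a \<in> F" "x = \<sigma> a" by blast
  show "- x \<in> \<sigma> ` F" "inverse x \<in> \<sigma> ` F"
    using a F(5,6) assms(2) by (metis image_eqI minus subsetD, metis image_eqI inverse subsetD)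
  fix y assume "y \<in> \<sigma> ` F"
  then obtain b where b: "b \<in> F" "y = \<sigma> b" by blast
  show "x + y \<in> \<sigma> ` F" "x * y \<in> \<sigma> ` F"
    using a b F(3,4) assms(2) by (metis image_eqI add subsetD, metis image_eqI mult subsetD)
qed

lemma preimage_subfield: "is_subfield F \<Longrightarrow> is_subfield {x \<in> L. \<sigma> x \<in> F}"
  unfolding is_subfield_def using closed
  by (auto simp: is_subfield_def zero one add mult minus inverse)

lemma fixed_subfield: "is_subfield {x \<in> L. \<sigma> x = x}"
  unfolding is_subfield_def using closed
  by (auto simp: is_subfield_def zero one add mult minus inverse)

text \<open>The coefficients lie in \<open>K\<close> and are fixed, so \<open>\<sigma>\<close> acts
  only on the entries of \<open>Z\<close>.\<close>

lemma matrix_polys_eval: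
  assumes "f \<in> matrix_polys K" "K \<subseteq> L" "\<And>x. x \<in> K \<Longrightarrow> \<sigma> x = x" "entries Z \<subseteq> L"
  shows "f Z \<in> L \<and> \<sigma> (f Z) = f (map_matrix \<sigma> Z)"
  using assms
  by (induction rule: matrix_polys.induct) (auto simp: closed add mult entries_subset_iff)

end

section \<open>Differential Galois groups under gauge transformations and algebraic extensions\<close>

lemma matrix_mult_add_left: "(A + B) ** C = A ** C + B ** C" for A :: "'a::semiring_1^'m^'n"
  by (simp add: vec_eq_iff matrix_mult_nth distrib_right sum.distrib)

lemma fundamental_matrix_gauge:
  fixes T :: "'a::field^'n^'n"
  assumes D: "derivation D" and T: "gauge_transformation D T A B" and Z: "fundamental_matrix D A Z"
  shows "fundamental_matrix D B (T ** Z)"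
proof -
  have "mderiv D (T ** Z) = (mderiv D T + T ** A) ** Z"
    using Z by (simp add: mderiv_mult[OF D] fundamental_matrix_def matrix_mul_assoc matrix_mult_add_left)
  also have "\<dots> = B ** (T ** Z)"
    by (simp add: gauge_transformationD(2)[OF T] matrix_mul_assoc)
  finally show ?thesis
    using Z gauge_transformationD(1)[OF T] by (simp add: fundamental_matrix_def invertible_mult)
qed

section \<open>Picard-Vessiot fields and their automorphisms\<close>

lemma picard_vessiot_subfield:
  assumes "picard_vessiot D K A Z"
  shows "is_subfield K" "is_subfield (adjoin K (entries Z))" "K \<subseteq> adjoin K (entries Z)"
    "entries Z \<subseteq> adjoin K (entries Z)"
  using assms by (auto simp: picard_vessiot_def diff_subfield_def subfield_adjoin
      adjoin_superset generators_adjoin)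

lemma picard_vessiot_diff_subfield:
  fixes A :: "'a::field^'n^'n"
  assumes D: "derivation D" and PV: "picard_vessiot D K A Z"
  shows "diff_subfield D (adjoin K (entries Z))"
proof (rule diff_subfield_adjoin[OF D])
  show "diff_subfield D K" using PV by (simp add: picard_vessiot_def)
  have "mderiv D Z = A ** Z" "entries A \<subseteq> adjoin K (entries Z)"
    using PV picard_vessiot_subfield(3)[OF PV] by (auto simp: picard_vessiot_def fundamental_matrix_def)
  then have "entries (mderiv D Z) \<subseteq> adjoin K (entries Z)"
    using entries_matrix_mult picard_vessiot_subfield(2,4)[OF PV] by metis
  then show "D x \<in> adjoin K (entries Z)" if "x \<in> entries Z" for x
    using that by (auto simp: entries_def mderiv_def)
qed

lemma diff_automorphisms_hom:
  assumes "\<sigma> \<in> diff_automorphisms D K L" "is_subfield L" "1 \<in> K"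
  shows "subfield_hom L \<sigma>"
  using assms by (simp add: subfield_hom_def diff_automorphisms_def)

text \<open>An automorphism over \<open>K\<close> fixes \<open>T\<close> entrywise, so it sends
  \<open>T Z\<close> to \<open>T\<close> times the image of \<open>Z\<close>; cancelling
  \<open>T\<close> shows that both fundamental matrices yield the same \<open>M\<close>.\<close>

lemma gauge_preserves_galois_group:
  fixes A T :: "'a::field^'n^'n"
  assumes D: "derivation D" and PV: "picard_vessiot D K A Z"
    and T: "gauge_transformation D T A B" "entries T \<subseteq> K" and B: "entries B \<subseteq> K"
  shows "picard_vessiot D K B (T ** Z)"
    and "diff_galois_group D K (T ** Z) = diff_galois_group D K Z"
proof -
  note invT = gauge_transformationD(1)[OF T(1)]
  note sub = picard_vessiot_subfield[OF PV]
  have adj: "adjoin K (entries (T ** Z)) = adjoin K (entries Z)"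
    by (rule adjoin_entries_mult[OF T(2) sub(1) invT])
  show "picard_vessiot D K B (T ** Z)"
    using PV B fundamental_matrix_gauge[OF D T(1)] by (simp add: picard_vessiot_def adj)
  have "map_matrix \<sigma> (T ** Z) = T ** Z ** M \<longleftrightarrow> map_matrix \<sigma> Z = Z ** M"
    if \<sigma>: "\<sigma> \<in> diff_automorphisms D K (adjoin K (entries Z))" for \<sigma> M
  proof -
    interpret subfield_hom "adjoin K (entries Z)" \<sigma>
      by (rule diff_automorphisms_hom[OF \<sigma> sub(2) subfield_1[OF sub(1)]])
    have "map_matrix \<sigma> T = T"
      using \<sigma> T(2) by (simp add: vec_eq_iff entries_subset_iff diff_automorphisms_def)
    then have "map_matrix \<sigma> (T ** Z) = T ** map_matrix \<sigma> Z"
      using T(2) sub(3,4) by (subst map_matrix_mult) auto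
    then show ?thesis
      by (simp add: matrix_mul_assoc[symmetric] matrix_mult_left_cancel[OF invT])
  qed
  then show "diff_galois_group D K (T ** Z) = diff_galois_group D K Z"
    unfolding diff_galois_group_def adj by blast
qed

text \<open>Since \<open>\<sigma>\<close> commutes with \<open>D\<close> and fixes \<open>A\<close>,
  the image of \<open>Z\<close> is again a matrix solution. Differentiating \<open>Z M\<close> then
  gives \<open>Z M' = 0\<close>, so \<open>M\<close> is constant, and \<open>K(Z)\<close> has no
  constants outside \<open>K\<close>.\<close>

lemma galois_matrix_entries_constant:
  fixes A :: "'a::field^'n^'n"
  assumes D: "derivation D" and PV: "picard_vessiot D K A Z"
    and \<sigma>: "\<sigma> \<in> diff_automorphisms D K (adjoin K (entries Z))" and M: "map_matrix \<sigma> Z = Z ** M"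
  shows "entries M \<subseteq> constants D K"
proof -
  let ?L = "adjoin K (entries Z)"
  note sub = picard_vessiot_subfield[OF PV]
  interpret subfield_hom ?L \<sigma>
    by (rule diff_automorphisms_hom[OF \<sigma> sub(2) subfield_1[OF sub(1)]])
  have Z: "invertible Z" "mderiv D Z = A ** Z" and A: "entries A \<subseteq> K"
    using PV by (auto simp: picard_vessiot_def fundamental_matrix_def)
  have "mderiv D (map_matrix \<sigma> Z) = map_matrix \<sigma> (mderiv D Z)"
    using \<sigma> sub(4) by (simp add: vec_eq_iff mderiv_def entries_subset_iff diff_automorphisms_def)
  also have "\<dots> = map_matrix \<sigma> A ** map_matrix \<sigma> Z"
    unfolding Z(2) using A sub(3,4) by (intro map_matrix_mult) auto
  also have "map_matrix \<sigma> A = A"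
    using \<sigma> A by (simp add: vec_eq_iff entries_subset_iff diff_automorphisms_def)
  finally have "A ** Z ** M + Z ** mderiv D M = A ** Z ** M"
    by (simp add: M mderiv_mult[OF D] Z(2) matrix_mul_assoc)
  then have "Z ** mderiv D M = Z ** 0"
    by simp
  then have "mderiv D M = 0"
    unfolding matrix_mult_left_cancel[OF Z(1)] .
  moreover have "entries M \<subseteq> ?L"
  proof -
    have "M = matrix_inv Z ** map_matrix \<sigma> Z"
      by (simp add: M matrix_mul_assoc matrix_inv_field[OF Z(1)])
    moreover have "entries (map_matrix \<sigma> Z) \<subseteq> ?L"
      using \<sigma> sub(4) by (auto simp: entries_subset_iff diff_automorphisms_def bij_betw_def)
    ultimately show ?thesis
      using entries_matrix_mult[OF sub(2) entries_matrix_inv[OF sub(2,4) Z(1)]] by metis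
  qed
  ultimately have "entries M \<subseteq> constants D ?L"
    by (auto simp: entries_subset_iff constants_def vec_eq_iff mderiv_def)
  then show ?thesis
    using PV by (simp add: picard_vessiot_def)
qed

text \<open>The matrix \<open>M\<close> has entries in the common constants, hence in
  \<open>K\<close>, so an automorphism of \<open>K'(Z)\<close> over \<open>K'\<close> maps
  \<open>K(Z)\<close> onto itself and can be restricted to it.\<close>

lemma galois_group_restrict:
  fixes A :: "'a::field^'n^'n"
  assumes D: "derivation D" and PV: "picard_vessiot D K A Z" and PV': "picard_vessiot D K' A Z"
    and K: "K \<subseteq> K'" "constants D K' = constants D K"
  shows "diff_galois_group D K' Z \<subseteq> diff_galois_group D K Z"
proof
  fix M assume "M \<in> diff_galois_group D K' Z"
  let ?L = "adjoin K (entries Z)" and ?L' = "adjoin K' (entries Z)"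
  obtain \<sigma> where \<sigma>: "\<sigma> \<in> diff_automorphisms D K' ?L'" and M: "map_matrix \<sigma> Z = Z ** M"
    using \<open>M \<in> _\<close> by (auto simp: diff_galois_group_def)
  note sub = picard_vessiot_subfield[OF PV] and sub' = picard_vessiot_subfield[OF PV']
  interpret subfield_hom ?L' \<sigma>
    by (rule diff_automorphisms_hom[OF \<sigma> sub'(2) subfield_1[OF sub'(1)]])
  have L: "?L \<subseteq> ?L'"
    by (intro adjoin_mono K generators_adjoin)
  have fix_K: "\<sigma> x = x" if "x \<in> K" for x
    using \<sigma> that K(1) by (auto simp: diff_automorphisms_def)
  have Z: "invertible Z"
    using PV by (auto simp: picard_vessiot_def fundamental_matrix_def)
  have M_K: "entries M \<subseteq> K"
    using galois_matrix_entries_constant[OF D PV' \<sigma> M] K(2) by (auto simp: constants_def)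
  \<comment> \<open>Applying \<open>\<sigma>\<close> to \<open>Z Z^-1 = 1\<close> exhibits a right
    inverse of \<open>M\<close>.\<close>
  have "map_matrix \<sigma> Z ** map_matrix \<sigma> (matrix_inv Z) = mat 1"
    using sub'(2,4) entries_matrix_inv[OF sub'(2,4) Z]
    by (simp add: map_matrix_mult[symmetric] matrix_inv_field[OF Z] map_matrix_mat_1)
  then have "Z ** (M ** map_matrix \<sigma> (matrix_inv Z)) = Z ** matrix_inv Z"
    by (simp add: M matrix_mul_assoc matrix_inv_field[OF Z])
  then have "M ** map_matrix \<sigma> (matrix_inv Z) = matrix_inv Z"
    unfolding matrix_mult_left_cancel[OF Z] .
  then have "M ** (map_matrix \<sigma> (matrix_inv Z) ** Z) = mat 1"
    by (simp add: matrix_mul_assoc matrix_inv_field[OF Z])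
  then have invM: "invertible M"
    using invertible_right_inverse by blast
  have N_K: "entries (matrix_inv M) \<subseteq> K"
    by (rule entries_matrix_inv[OF sub(1) M_K invM])
  have fix_N: "map_matrix \<sigma> (matrix_inv M) = matrix_inv M"
    using N_K fix_K by (simp add: vec_eq_iff entries_subset_iff)
  have image: "\<sigma> ` ?L = ?L"
  proof
    have "entries (map_matrix \<sigma> Z) \<subseteq> ?L"
      unfolding M using M_K sub by (intro entries_matrix_mult) auto
    then have "\<sigma> z \<in> ?L" if "z \<in> entries Z" for z
      using that by (fastforce simp: entries_subset_iff entries_def)
    \<comment> \<open>The elements sent into \<open>K(Z)\<close> form a subfield, so the generators
      decide.\<close>
    then have "?L \<subseteq> {x \<in> ?L'. \<sigma> x \<in> ?L}"
      using sub(3) sub'(4) L fix_K by (intro adjoin_least preimage_subfield sub(2)) auto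
    then show "\<sigma> ` ?L \<subseteq> ?L" by blast
    \<comment> \<open>For surjectivity, \<open>Z\<close> is the image of \<open>Z M^-1\<close>,
      because the entries of \<open>M^-1\<close> lie in \<open>K\<close> and are fixed.\<close>
    have "Z = map_matrix \<sigma> Z ** map_matrix \<sigma> (matrix_inv M)"
      by (simp add: M fix_N matrix_mul_assoc[symmetric] matrix_inv_field[OF invM])
    also have "\<dots> = map_matrix \<sigma> (Z ** matrix_inv M)"
      using N_K K(1) sub' by (intro map_matrix_mult[symmetric]) auto
    finally have "Z = map_matrix \<sigma> (Z ** matrix_inv M)" .
    moreover have "entries (Z ** matrix_inv M) \<subseteq> ?L"
      using N_K sub by (intro entries_matrix_mult) auto
    ultimately have "entries Z \<subseteq> \<sigma> ` ?L"
      by (metis (no_types, lifting) entries_subset_iff image_eqI nth_map_matrix)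
    moreover have "K \<subseteq> \<sigma> ` ?L"
      using fix_K sub(3) by (metis image_eqI subsetD subsetI)
    ultimately show "?L \<subseteq> \<sigma> ` ?L"
      by (intro adjoin_least image_subfield sub(2) L)
  qed
  have "D x \<in> ?L" if "x \<in> ?L" for x
    using picard_vessiot_diff_subfield[OF D PV] that by (auto simp: diff_subfield_def)
  then have "restrict \<sigma> ?L \<in> diff_automorphisms D K ?L"
    using \<sigma> L image inj_on_subset[OF inj_on L] fix_K sub(3) subfield_closed[OF sub(2)]
    by (auto simp: diff_automorphisms_def bij_betw_def inj_on_def subset_iff)
  moreover have "map_matrix (restrict \<sigma> ?L) Z = Z ** M"
    using sub(4) M by (simp add: vec_eq_iff entries_subset_iff)
  ultimately show "M \<in> diff_galois_group D K Z"
    unfolding diff_galois_group_def by blast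
qed

text \<open>Quotients of polynomials in the entries of \<open>Z\<close> already form a subfield.
  They serve to turn conditions on an automorphism of \<open>K(Z)\<close> into polynomial equations
  in its matrix.\<close>

lemma adjoin_entries_quotient:
  assumes K: "is_subfield K" and x: "x \<in> adjoin K (entries Z)"
  shows "\<exists>u\<in>matrix_polys K. \<exists>v\<in>matrix_polys K. v Z \<noteq> 0 \<and> x = u Z / v Z"
proof -
  let ?F = "{u Z / v Z | u v. u \<in> matrix_polys K \<and> v \<in> matrix_polys K \<and> v Z \<noteq> 0}"
  have I: "u Z / v Z \<in> ?F" if "u \<in> matrix_polys K" "v \<in> matrix_polys K" "v Z \<noteq> 0" for u v
    using that by blast
  have const: "c \<in> ?F" if "c \<in> K" for c
    using I[OF matrix_polys.const[OF that] matrix_polys.const[OF subfield_1[OF K]]] by simp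
  have entry: "Z $ j $ k \<in> ?F" for j k
    using I[OF matrix_polys.entry matrix_polys.const[OF subfield_1[OF K]], of j k] by simp
  have "is_subfield ?F"
    unfolding is_subfield_def
  proof (intro conjI ballI)
    show "0 \<in> ?F" "1 \<in> ?F"
      by (rule const[OF subfield_0[OF K]], rule const[OF subfield_1[OF K]])
    fix a assume "a \<in> ?F"
    then obtain u v where a: "u \<in> matrix_polys K" "v \<in> matrix_polys K" "v Z \<noteq> 0" "a = u Z / v Z"
      by blast
    have m1: "- 1 \<in> K" by (rule subfield_minus[OF K subfield_1[OF K]])
    show "- a \<in> ?F"
      using I[OF matrix_polys.mult[OF matrix_polys.const[OF m1] a(1)] a(2)] a(3,4) by simp
    \<comment> \<open>If the numerator vanishes, then \<open>a = 0\<close>, and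
      \<open>inverse 0 = 0\<close> by convention.\<close>
    show "inverse a \<in> ?F"
      using I[OF a(2,1)] const[OF subfield_0[OF K]] a(3,4) by (cases "u Z = 0") simp_all
    fix b assume "b \<in> ?F"
    then obtain u' v' where b: "u' \<in> matrix_polys K" "v' \<in> matrix_polys K" "v' Z \<noteq> 0" "b = u' Z / v' Z"
      by blast
    note vv' = matrix_polys.mult[OF a(2) b(2)]
    show "a + b \<in> ?F"
      using I[OF matrix_polys.add[OF matrix_polys.mult[OF a(1) b(2)] matrix_polys.mult[OF b(1) a(2)]] vv']
      by (simp add: a(3,4) b(3,4) add_frac_eq)
    show "a * b \<in> ?F"
      using I[OF matrix_polys.mult[OF a(1) b(1)] vv'] by (simp add: a(3,4) b(3,4))
  qed
  moreover have "K \<subseteq> ?F" by (rule subsetI) (rule const)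
  moreover have "entries Z \<subseteq> ?F" unfolding entries_subset_iff by (intro allI entry)
  ultimately have "adjoin K (entries Z) \<subseteq> ?F" by (rule adjoin_least)
  then show ?thesis using x by blast
qed

text \<open>The extension \<open>\<tau>\<close> applies \<open>\<sigma>\<close> to the coefficients
  of a polynomial in \<open>x\<close>. Two representatives of the same value differ by a multiple of
  \<open>g\<close>, and \<open>\<sigma>\<close> preserves such multiples because it fixes
  \<open>g\<close>; hence \<open>\<tau>\<close> is well defined.\<close>

lemma extend_automorphism:
  fixes L :: "'a::field set"
  assumes D: "derivation D" and L: "diff_subfield D L" and K: "K \<subseteq> L" "1 \<in> K"
    and x: "algebraic_over L x" "D x \<in> adjoin K {x}"
    and g: "poly g x = 0"
      "\<And>h. h \<in> polys_over L \<Longrightarrow> poly h x = 0 \<Longrightarrow> \<exists>q\<in>polys_over L. h = g * q" "g \<in> polys_over L"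
    and \<sigma>: "\<sigma> \<in> diff_automorphisms D K L" "map_poly \<sigma> g = g"
  obtains \<tau> where "\<tau> \<in> diff_automorphisms D (adjoin K {x}) (adjoin L {x})"
    "\<And>y. y \<in> L \<Longrightarrow> \<tau> y = \<sigma> y"
proof -
  have sub: "is_subfield L" using L by (simp add: diff_subfield_def)
  interpret \<sigma>: subfield_hom L \<sigma>
    by (rule diff_automorphisms_hom[OF \<sigma>(1) sub K(2)])
  let ?L = "adjoin L {x}"
  note Lx = adjoin_algebraic[OF sub x(1)]
  define \<tau> where "\<tau> = restrict (\<lambda>y. poly (map_poly \<sigma> (SOME h. h \<in> polys_over L \<and> y = poly h x)) x) ?L"
  have in_L: "poly h x \<in> ?L" if "h \<in> polys_over L" for h
    using that by (auto simp: Lx)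
  have \<tau>: "\<tau> (poly h x) = poly (map_poly \<sigma> h) x" if h: "h \<in> polys_over L" for h
  proof -
    define k where "k = (SOME k. k \<in> polys_over L \<and> poly h x = poly k x)"
    have k: "k \<in> polys_over L" "poly h x = poly k x"
      using someI[of "\<lambda>k. k \<in> polys_over L \<and> poly h x = poly k x" h] h by (auto simp: k_def)
    obtain q where q: "q \<in> polys_over L" "k - h = g * q"
      using g(2)[of "k - h"] k h polys_over_diff[OF sub] by auto
    have "map_poly \<sigma> k = map_poly \<sigma> (h + g * q)"
      using q(2) by (simp add: algebra_simps)
    also have "\<dots> = map_poly \<sigma> h + g * map_poly \<sigma> q"
      using h q(1) g(3) by (simp add: \<sigma>.map_poly_add \<sigma>.map_poly_mult polys_over_mult[OF sub] \<sigma>(2))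
    finally show ?thesis
      using in_L[OF h] g(1) by (simp add: \<tau>_def k_def[symmetric])
  qed
  have const: "[:y:] \<in> polys_over L" if "y \<in> L" for y
    using that by (simp add: polys_over_pCons[OF sub] polys_over_0[OF sub])
  have \<tau>_L: "\<tau> y = \<sigma> y" if "y \<in> L" for y
    using \<tau>[OF const[OF that]] by (simp add: map_poly_pCons \<sigma>.zero)
  interpret \<tau>: subfield_hom ?L \<tau>
  proof
    show "is_subfield ?L" by (rule subfield_adjoin)
    show "\<tau> 1 = 1" using \<tau>_L[of 1] \<sigma>.one \<sigma>.closed(2) by simp
    fix y z assume "y \<in> ?L" "z \<in> ?L"
    then obtain h k where h: "h \<in> polys_over L" "y = poly h x" and k: "k \<in> polys_over L" "z = poly k x"
      by (auto simp: Lx)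
    show "\<tau> (y + z) = \<tau> y + \<tau> z"
      using \<tau>[OF polys_over_add[OF sub h(1) k(1)]] h k by (simp add: \<tau> \<sigma>.map_poly_add)
    show "\<tau> (y * z) = \<tau> y * \<tau> z"
      using \<tau>[OF polys_over_mult[OF sub h(1) k(1)]] h k by (simp add: \<tau> \<sigma>.map_poly_mult)
  qed
  have x_in: "x \<in> ?L" using generators_adjoin by blast
  have X: "[:0, 1:] \<in> polys_over L"
    by (simp add: polys_over_pCons[OF sub] polys_over_0[OF sub] \<sigma>.closed)
  have \<tau>_x: "\<tau> x = x"
    using \<tau>[OF X] by (simp add: map_poly_pCons \<sigma>.zero \<sigma>.one)
  have KL: "adjoin K {x} \<subseteq> ?L"
    using K(1) generators_adjoin by (rule adjoin_mono)
  have fix_K: "\<tau> y = y" if "y \<in> adjoin K {x}" for y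
  proof -
    have "\<tau> y = y" if "y \<in> K" for y
      using \<tau>_L[of y] K(1) \<sigma>(1) that by (auto simp: diff_automorphisms_def)
    then have "adjoin K {x} \<subseteq> {y \<in> ?L. \<tau> y = y}"
      using K(1) adjoin_superset[of L "{x}"] x_in \<tau>_x
      by (intro adjoin_least \<tau>.fixed_subfield) auto
    then show ?thesis using that by blast
  qed
  have dL: "diff_subfield D ?L"
    using KL x(2) by (intro diff_subfield_adjoin[OF D L]) auto
  have D_in: "D y \<in> ?L" if "y \<in> ?L" for y
    using dL that by (auto simp: diff_subfield_def)
  \<comment> \<open>Horner's scheme reduces commutation with \<open>D\<close> to the coefficients,
    where it holds for \<open>\<sigma>\<close>, and to \<open>x\<close>, where it holds because
    \<open>x\<close> and \<open>D x\<close> both lie in \<open>adjoin K {x}\<close>, which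
    \<open>\<tau>\<close> fixes.\<close>
  have comm: "\<tau> (D (poly h x)) = D (\<tau> (poly h x))" if "h \<in> polys_over L" for h
    using that
  proof (induction h)
    case 0
    then show ?case by (simp add: derivation_0[OF D] \<tau>.zero)
  next
    case (pCons a h)
    have a: "a \<in> L" and h: "h \<in> polys_over L"
      using pCons.prems by (simp_all add: polys_over_pCons[OF sub])
    have a': "a \<in> ?L" using a adjoin_superset by blast
    let ?y = "poly h x"
    note y = in_L[OF h]
    have "\<tau> (D a) = D (\<tau> a)"
    proof -
      have "D a \<in> L" using L a by (auto simp: diff_subfield_def)
      then show ?thesis using \<sigma>(1) a by (simp add: \<tau>_L diff_automorphisms_def)
    qed
    moreover have "\<tau> (D x) = D x" by (rule fix_K[OF x(2)])
    ultimately show ?case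
      using pCons.IH[OF h] a' y x_in
      by (simp add: derivation_add[OF D] derivation_mult[OF D] \<tau>.add \<tau>.mult \<tau>.closed D_in \<tau>_x)
  qed
  have "bij_betw \<tau> ?L ?L"
    unfolding bij_betw_def
  proof (intro conjI equalityI subsetI)
    show "inj_on \<tau> ?L" by (rule \<tau>.inj_on)
    have bij: "bij_betw \<sigma> L L" using \<sigma>(1) by (simp add: diff_automorphisms_def)
    fix y
    {
      assume "y \<in> \<tau> ` ?L"
      then obtain h where h: "h \<in> polys_over L" "y = poly (map_poly \<sigma> h) x"
        by (auto simp: Lx \<tau>)
      then have "map_poly \<sigma> h \<in> polys_over L"
        using bij by (auto simp: polys_over_def coeff_map_poly \<sigma>.zero bij_betw_def)
      then show "y \<in> ?L" using in_L h(2) by simp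
    next
      assume "y \<in> ?L"
      then obtain h where h: "h \<in> polys_over L" "y = poly h x" by (auto simp: Lx)
      \<comment> \<open>Preimages are found by undoing \<open>\<sigma>\<close> on the coefficients;
        \<open>?i 0 = 0\<close> is what makes \<open>map_poly\<close> act coefficientwise.\<close>
      let ?i = "inv_into L \<sigma>"
      have i0: "?i 0 = 0"
        using inv_into_f_f[OF \<sigma>.inj_on \<sigma>.closed(1)] by (simp add: \<sigma>.zero)
      have i: "?i z \<in> L" "\<sigma> (?i z) = z" if "z \<in> L" for z
        using bij that by (auto simp: bij_betw_def inv_into_into f_inv_into_f)
      have "map_poly ?i h \<in> polys_over L" "map_poly \<sigma> (map_poly ?i h) = h"
        using h(1) by (auto simp: polys_over_def coeff_map_poly i0 i \<sigma>.zero intro!: poly_eqI)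
      then have "y = \<tau> (poly (map_poly ?i h) x)" "poly (map_poly ?i h) x \<in> ?L"
        using h(2) by (simp_all add: \<tau> in_L)
      then show "y \<in> \<tau> ` ?L" by blast
    }
  qed
  moreover have "\<forall>y\<in>?L. \<tau> (D y) = D (\<tau> y)"
    using comm by (auto simp: Lx)
  moreover have "\<tau> \<in> extensional ?L" by (simp add: \<tau>_def)
  ultimately have "\<tau> \<in> diff_automorphisms D (adjoin K {x}) ?L"
    using \<tau>.add \<tau>.mult fix_K by (simp add: diff_automorphisms_def)
  then show ?thesis using that \<tau>_L by blast
qed


text \<open>The group over \<open>adjoin K {\<theta>}\<close> lies in the group over
  \<open>K\<close> and contains a clopen neighbourhood of the identity there, namely the stabiliser
  of the minimal polynomial of \<open>\<theta>\<close>; so the component of the identity is the same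
  in both.\<close>

lemma galois_identity_component_adjoin:
  fixes A :: "'a::field^'n^'n"
  assumes D: "derivation D" and C: "algebraically_closed (constants D K)"
    and PV: "picard_vessiot D K A Z"
    and \<theta>: "algebraic_over K \<theta>" "D \<theta> \<in> adjoin K {\<theta>}"
  shows "picard_vessiot D (adjoin K {\<theta>}) A Z"
    and "galois_identity_component D (adjoin K {\<theta>}) Z = galois_identity_component D K Z"
proof -
  let ?K' = "adjoin K {\<theta>}" and ?L = "adjoin K (entries Z)"
  note sub = picard_vessiot_subfield[OF PV]
  have dK: "diff_subfield D K" using PV by (simp add: picard_vessiot_def)
  have constL: "constants D ?L = constants D K" using PV by (simp add: picard_vessiot_def)
  have dL: "diff_subfield D ?L" by (rule picard_vessiot_diff_subfield[OF D PV])
  have alg: "algebraic_over ?L \<theta>"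
    using \<theta>(1) sub(3) unfolding algebraic_over_def by blast
  have dK': "diff_subfield D ?K'"
    using \<theta>(2) by (intro diff_subfield_adjoin[OF D dK]) auto
  have constK': "constants D ?K' = constants D K"
    by (rule constants_adjoin_algebraic[OF D dK C \<theta>(1)])
  \<comment> \<open>Adjoining in the other order makes the new field a simple algebraic extension of
    \<open>K(Z)\<close>, whose constants are known.\<close>
  have L': "adjoin ?K' (entries Z) = adjoin ?L {\<theta>}"
    by (rule adjoin_commute)
  have constL': "constants D (adjoin ?K' (entries Z)) = constants D ?K'"
    unfolding L' constK' using constants_adjoin_algebraic[OF D dL _ alg] C constL by simp
  have KK': "K \<subseteq> ?K'" by (rule adjoin_superset)
  show PV': "picard_vessiot D ?K' A Z"
    using PV dK' constL' KK' by (auto simp: picard_vessiot_def)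

  have subC: "is_subfield (constants D K)" by (rule subfield_constants[OF D sub(1)])
  let ?G = "diff_galois_group D K Z" and ?G' = "diff_galois_group D ?K' Z"
  define X where "X = subtopology (zariski (constants D K)) ?G"
  have topX: "topspace X = {M \<in> ?G. entries M \<subseteq> constants D K}"
    by (auto simp: X_def topspace_zariski[OF subfield_1[OF subC]])
  have GG': "?G' \<subseteq> ?G"
    by (rule galois_group_restrict[OF D PV PV' KK' constK'])

  obtain f where f: "f \<in> polys_over K" "f \<noteq> 0" "poly f \<theta> = 0"
    using \<theta>(1) by (auto simp: algebraic_over_def polys_over_def)
  have fL: "f \<in> polys_over ?L" using f(1) polys_over_mono[OF sub(3)] by blast
  obtain g where g: "g \<in> polys_over ?L" "lead_coeff g = 1" "poly g \<theta> = 0"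
    and gmin: "\<And>h. h \<in> polys_over ?L \<Longrightarrow> poly h \<theta> = 0 \<Longrightarrow> \<exists>q\<in>polys_over ?L. h = g * q"
    using minimal_polynomial[OF sub(2) alg] by metis
  obtain q where q: "q \<in> polys_over ?L" "f = g * q" using gmin[OF fL f(3)] by blast
  \<comment> \<open>Every conjugate of \<open>g\<close> is a monic divisor of \<open>f\<close>,
    whose coefficients lie in \<open>K\<close> and are fixed; this makes the orbit of
    \<open>g\<close> finite.\<close>
  define H where "H = {d. d dvd f \<and> lead_coeff d = 1}"
  have finH: "finite H" unfolding H_def by (rule finite_monic_divisors[OF f(2)])

  have "\<exists>\<sigma>. M \<in> ?G \<longrightarrow> \<sigma> \<in> diff_automorphisms D K ?L \<and> map_matrix \<sigma> Z = Z ** M" for M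
    by (auto simp: diff_galois_group_def)
  then obtain aut where aut: "\<And>M. M \<in> ?G \<Longrightarrow> aut M \<in> diff_automorphisms D K ?L"
    "\<And>M. M \<in> ?G \<Longrightarrow> map_matrix (aut M) Z = Z ** M"
    by metis
  have hom: "subfield_hom ?L (aut M)" if "M \<in> ?G" for M
    by (rule diff_automorphisms_hom[OF aut(1)[OF that] sub(2) subfield_1[OF sub(1)]])
  have aut_K: "aut M x = x" if "M \<in> ?G" "x \<in> K" for M x
    using aut(1)[OF that(1)] that(2) by (simp add: diff_automorphisms_def)
  have in_H: "map_poly (aut M) g \<in> H" if M: "M \<in> ?G" for M
  proof -
    interpret subfield_hom ?L "aut M" by (rule hom[OF M])
    have "f = map_poly (aut M) f"
      using f(1) aut_K[OF M] by (intro poly_eqI) (simp add: coeff_map_poly zero polys_over_def)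
    also have "\<dots> = map_poly (aut M) g * map_poly (aut M) q"
      unfolding q(2) by (rule map_poly_mult[OF g(1) q(1)])
    finally have "map_poly (aut M) g dvd f" by (rule dvdI)
    moreover have "lead_coeff (map_poly (aut M) g) = 1"
      using g(2) by (subst lead_coeff_map_poly_nz) (simp_all add: zero one)
    ultimately show ?thesis by (simp add: H_def)
  qed

  have "\<exists>u v. u \<in> matrix_polys K \<and> v \<in> matrix_polys K \<and> v Z \<noteq> 0 \<and> coeff g k = u Z / v Z" for k
    using adjoin_entries_quotient[OF sub(1), of "coeff g k" Z] g(1) by (auto simp: polys_over_def)
  then obtain u v where uv: "\<And>k. u k \<in> matrix_polys K" "\<And>k. v k \<in> matrix_polys K"
    "\<And>k. v k Z \<noteq> 0" "\<And>k. coeff g k = u k Z / v k Z"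
    by metis
  \<comment> \<open>Clearing denominators in each coefficient turns membership in a fibre of the
    orbit map into polynomial equations in \<open>M\<close>; the denominators stay nonzero because
    \<open>aut M\<close> is injective.\<close>
  have conj_iff: "map_poly (aut M) g = h \<longleftrightarrow> (\<forall>k. u k (Z ** M) + - coeff h k * v k (Z ** M) = 0)"
    if M: "M \<in> ?G" for M h
  proof -
    interpret subfield_hom ?L "aut M" by (rule hom[OF M])
    have "aut M (coeff g k) = coeff h k \<longleftrightarrow> u k (Z ** M) + - coeff h k * v k (Z ** M) = 0" for k
    proof -
      have u: "u k Z \<in> ?L" "aut M (u k Z) = u k (Z ** M)"
        using matrix_polys_eval[OF uv(1) sub(3) aut_K[OF M] sub(4)] aut(2)[OF M] by auto
      have v: "v k Z \<in> ?L" "aut M (v k Z) = v k (Z ** M)"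
        using matrix_polys_eval[OF uv(2) sub(3) aut_K[OF M] sub(4)] aut(2)[OF M] by auto
      have "v k (Z ** M) \<noteq> 0"
        using v eq_0_iff uv(3) by metis
      moreover have "aut M (coeff g k) = u k (Z ** M) / v k (Z ** M)"
        unfolding uv(4) using u v by (simp add: divide)
      ultimately show ?thesis by (simp add: divide_eq_eq)
    qed
    then show ?thesis
      by (simp add: poly_eq_iff coeff_map_poly zero)
  qed

  \<comment> \<open>\<open>S h\<close> is the fibre over \<open>h\<close> of the orbit map of
    \<open>g\<close>, so \<open>S g\<close> is the stabiliser.\<close>
  define S where "S h = {M \<in> topspace X. map_poly (aut M) g = h}" for h
  have closed: "closedin X (S h)" for h
  proof -
    let ?T = "\<lambda>k. {M. entries M \<subseteq> constants D K \<and> u k (Z ** M) + - coeff h k * v k (Z ** M) = 0}"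
    have "closedin (zariski (constants D K)) (?T k)" for k
      using uv(1,2)[of k]
      by (intro closedin_zariski_zero_set[OF subC] matrix_polys.intros matrix_polys_compose_mult) auto
    then have "closedin (zariski (constants D K)) (\<Inter>k. ?T k)"
      by (intro closedin_Inter) auto
    moreover have "S h = (\<Inter>k. ?T k) \<inter> ?G"
      unfolding S_def topX using conj_iff by auto
    ultimately show ?thesis
      unfolding X_def closedin_subtopology by blast
  qed
  \<comment> \<open>The complement of the stabiliser is a finite union of closed fibres, so the
    stabiliser is open as well as closed.\<close>
  have "topspace X - S g = (\<Union>h\<in>H - {g}. S h)"
    using in_H by (auto simp: S_def topX)
  moreover have "closedin X (\<Union>h\<in>H - {g}. S h)"
    using finH closed by (intro closedin_Union) auto
  ultimately have open_S: "openin X (S g)"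
    using closed[of g] by (metis closedin_subset openin_closedin_eq)

  have "S g \<subseteq> ?G'"
  proof
    fix M assume "M \<in> S g"
    then have M: "M \<in> ?G" "map_poly (aut M) g = g" by (auto simp: S_def topX)
    obtain \<tau> where \<tau>: "\<tau> \<in> diff_automorphisms D ?K' (adjoin ?L {\<theta>})"
      "\<And>y. y \<in> ?L \<Longrightarrow> \<tau> y = aut M y"
      using extend_automorphism[OF D dL sub(3) subfield_1[OF sub(1)] alg \<theta>(2) g(3) gmin g(1)
          aut(1)[OF M(1)] M(2)] by blast
    have "map_matrix \<tau> Z = map_matrix (aut M) Z"
      using \<tau>(2) sub(4) by (simp add: vec_eq_iff entries_subset_iff)
    then show "M \<in> ?G'"
      using \<tau>(1) aut(2)[OF M(1)] unfolding diff_galois_group_def L' by auto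
  qed
  moreover have "connected_component_of_set X (mat 1) \<subseteq> S g"
  proof -
    have "D x \<in> ?L" if "x \<in> ?L" for x
      using dL that by (auto simp: diff_subfield_def)
    then have "restrict id ?L \<in> diff_automorphisms D K ?L"
      using sub(3) by (auto simp: diff_automorphisms_def bij_betw_def inj_on_def
          subfield_closed[OF sub(2)])
    moreover have "map_matrix (restrict id ?L) Z = Z ** mat 1"
      using sub(4) by (simp add: vec_eq_iff entries_subset_iff)
    ultimately have one_G: "mat 1 \<in> ?G" unfolding diff_galois_group_def by blast
    then have "mat 1 \<in> topspace X"
      by (simp add: topX entries_mat_1[OF subC])
    \<comment> \<open>At the identity matrix the equations of \<open>conj_iff\<close> reduce to the
      representation of the coefficients of \<open>g\<close> as quotients.\<close>
    moreover have "map_poly (aut (mat 1)) g = g"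
      unfolding conj_iff[OF one_G] using uv(3,4) by simp
    ultimately have "mat 1 \<in> S g" by (simp add: S_def)
    moreover have "mat 1 \<in> connected_component_of_set X (mat 1)"
      using \<open>mat 1 \<in> topspace X\<close> by (simp add: connected_component_of_refl)
    moreover have "connected_component_of_set X (mat 1) \<subseteq> S g
        \<or> disjnt (connected_component_of_set X (mat 1)) (S g)"
      by (rule connectedin_clopen_cases[OF connectedin_connected_component_of closed open_S])
    ultimately show ?thesis by (auto simp: disjnt_iff)
  qed
  ultimately have "connected_component_of_set X (mat 1) \<subseteq> ?G'" by blast
  \<comment> \<open>A component contained in a subspace is also the component of its point within
    that subspace.\<close>
  then have "connected_component_of (subtopology X ?G') (mat 1) = connected_component_of X (mat 1)"
    by (simp add: connected_component_of_subtopology_eq)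
  moreover have "subtopology X ?G' = subtopology (zariski (constants D K)) ?G'"
    using GG' by (simp add: X_def subtopology_subtopology Int_absorb1)
  ultimately show "galois_identity_component D ?K' Z = galois_identity_component D K Z"
    by (simp add: galois_identity_component_def constK' X_def)
qed

section \<open>The Darboux transformation\<close>

lemma matrix_3_eq_iff: "A = B \<longleftrightarrow> (\<forall>i j. A $ i $ j = B $ i $ j)" for A B :: "'a^3^3"
  by (simp add: vec_eq_iff)

lemma mscale_nth: "mscale c A $ i $ j = c * A $ i $ j"
  by (simp add: mscale_def)

definition matQ_inv :: "'a::field \<Rightarrow> 'a^3^3" where
  "matQ_inv \<iota> = vector [vector [1 / 2, - \<iota> / 2, 0], vector [0, 0, - 1], vector [- 1 / 2, - \<iota> / 2, 0]]"

lemma matQ_inverse: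
  fixes \<iota> :: "'a::field_char_0"
  assumes "\<iota>\<^sup>2 = - 1"
  shows "invertible (matQ \<iota>)" "matrix_inv (matQ \<iota>) = matQ_inv \<iota>"
proof -
  have "\<iota> * \<iota> = - 1" using assms by (simp add: power2_eq_square)
  then have *: "matQ \<iota> ** matQ_inv \<iota> = mat 1"
    by (simp add: matrix_3_eq_iff forall_3 matrix_mult_nth sum_3 matQ_def matQ_inv_def mat_def)
  then show inv: "invertible (matQ \<iota>)"
    using invertible_right_inverse by blast
  show "matrix_inv (matQ \<iota>) = matQ_inv \<iota>"
    using * matrix_mult_left_cancel[OF inv] matrix_inv_field(1)[OF inv] by metis
qed

lemma matQ_conjugate_matP:
  fixes \<iota> r :: "'a::field_char_0"
  assumes "\<iota>\<^sup>2 = - 1" "r \<noteq> 0"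
  shows "matQ \<iota> ** matP r \<theta> \<rho> \<nu> ** matrix_inv (matQ \<iota>) = mscale (1 / (2 * r)) (vector
    [vector [- (\<nu>\<^sup>2) + \<rho>\<^sup>2 + \<theta>\<^sup>2 - 1, \<iota> * (\<nu>\<^sup>2 + \<rho>\<^sup>2 - \<theta>\<^sup>2 - 1), 2 * (\<nu> * \<rho> + \<theta>)],
     vector [\<iota> * (\<nu>\<^sup>2 - \<rho>\<^sup>2 + \<theta>\<^sup>2 - 1), \<nu>\<^sup>2 + \<rho>\<^sup>2 + \<theta>\<^sup>2 + 1, 2 * \<iota> * (\<theta> - \<nu> * \<rho>)],
     vector [2 * (\<nu> * \<theta> + \<rho>), - (2 * \<iota> * (\<nu> * \<theta> - \<rho>)), 2 * (\<nu> - \<theta> * \<rho>)]])"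
proof -
  have \<iota>: "\<iota> * \<iota> = - 1" "\<And>x. \<iota> * (\<iota> * x) = - x"
    using assms(1) by (simp_all add: power2_eq_square flip: mult.assoc)
  show ?thesis
    using assms(2) unfolding matQ_inverse(2)[OF assms(1)]
    by (simp add: matrix_3_eq_iff forall_3 matrix_mult_nth sum_3 matQ_def matQ_inv_def matP_def
        mscale_nth)
       (simp add: field_simps \<iota>)
qed

text \<open>The determinant collapses to \<open>- (m ^ 3)\<close>, because
  \<open>\<nu> + \<theta> * \<rho> = m * r\<close> and the scalar factor contributes
  \<open>1 / r ^ 3\<close>.\<close>

lemma invertible_matP:
  fixes r :: "'a::field"
  assumes "r \<noteq> 0" "m \<noteq> 0" "\<nu> = m * r - \<theta> * \<rho>"
  shows "invertible (matP r \<theta> \<rho> \<nu>)"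
proof -
  define c where "c = 1 / r"
  have "det (matP r \<theta> \<rho> \<nu>) = - (c ^ 3 * (\<nu> + \<theta> * \<rho>) ^ 3)"
    unfolding det_3 matP_def mscale_nth vector_3 c_def[symmetric]
    by (simp add: algebra_simps power2_eq_square power3_eq_cube)
  also have "\<nu> + \<theta> * \<rho> = m * r" by (simp add: assms(3))
  finally show ?thesis using assms(1,2) by (simp add: invertible_det_nz c_def)
qed

text \<open>In the coordinates given by \<open>Q\<close> the system is the second symmetric power of
  \<open>y'' + p y' + (q - m r) y = 0\<close>, up to a scalar gauge factor.\<close>

definition sym_square_matrix :: "'a::field \<Rightarrow> 'a \<Rightarrow> 'a^3^3" where
  "sym_square_matrix p \<kappa> = vector [vector [p, 1, 0], vector [- (2 * \<kappa>), 0, 2], vector [0, - \<kappa>, - p]]"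

text \<open>For constant \<open>\<iota>\<close> the matrix \<open>matQ \<iota>\<close> has zero
  derivative, so this intertwining relation is the gauge equation for the change of coordinates by
  \<open>matQ \<iota>\<close>.\<close>

lemma Sys_matQ:
  fixes \<iota> :: "'a::field_char_0"
  assumes "\<iota>\<^sup>2 = - 1"
  shows "Sys \<iota> p q r m ** matQ \<iota> = matQ \<iota> ** sym_square_matrix p (q - m * r)"
proof -
  have \<iota>: "\<iota> * \<iota> = - 1" "\<And>x. \<iota> * (\<iota> * x) = - x"
    using assms(1) by (simp_all add: power2_eq_square flip: mult.assoc)
  show ?thesis
    by (simp add: matrix_3_eq_iff forall_3 matrix_mult_nth sum_3 matQ_def Sys_def Omega0_def N3_def
        sym_square_matrix_def mscale_nth)
       (simp add: algebra_simps \<iota>)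
qed

text \<open>The Riccati equations for \<open>\<theta>\<close> and \<open>\<rho>\<close>, together
  with \<open>D r = - 2 * r * (\<theta> + p + \<rho>)\<close>, eliminate all derivatives, and nine
  polynomial identities remain. Here \<open>q'\<close> is the transformed potential.\<close>

lemma matP_gauge:
  fixes r :: "'a::field_char_0"
  assumes D: "derivation D" and r: "r \<noteq> 0" and Dm: "D m = 0"
    and \<theta>: "D \<theta> = - \<theta>\<^sup>2 - p * \<theta> - q" and \<rho>: "\<rho> = - \<theta> - p - D r / (2 * r)"
    and D\<rho>: "D \<rho> = - \<rho>\<^sup>2 - p * \<rho> - q'" and \<nu>: "\<nu> = m * r - \<theta> * \<rho>"
  shows "mderiv D (matP r \<theta> \<rho> \<nu>) + matP r \<theta> \<rho> \<nu> ** sym_square_matrix p (q - m * r)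
    = sym_square_matrix p (q' - m * r) ** matP r \<theta> \<rho> \<nu>"
proof -
  have Dr: "D r = - 2 * r * (\<theta> + p + \<rho>)"
    unfolding \<rho> using r by (simp add: field_simps)
  define c where "c = 1 / r"
  \<comment> \<open>The common factor \<open>1 / r\<close> is differentiated once and for all, which
    leaves only polynomial entries to treat.\<close>
  have D_scale: "D (c * e) = c * (D e + 2 * (\<theta> + p + \<rho>) * e)" for e
    using r by (simp add: c_def derivation_divide[OF D] Dr field_simps power2_eq_square)
  have D\<nu>: "D \<nu> = - 2 * m * r * (\<theta> + p + \<rho>) - D \<theta> * \<rho> - \<theta> * D \<rho>"
    by (simp add: \<nu> derivation_diff[OF D] derivation_mult[OF D] Dm Dr)
  note der = derivation_add[OF D] derivation_diff[OF D] derivation_mult[OF D] derivation_minus[OF D]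
    derivation_numeral[OF D] derivation_1[OF D] D\<nu> D\<rho> \<theta>
  show ?thesis
    unfolding matrix_3_eq_iff forall_3 vector_add_component matrix_mult_nth sum_3 mderiv_def
      nth_map_matrix matP_def mscale_nth c_def[symmetric] D_scale sym_square_matrix_def vector_3
    unfolding power2_eq_square der \<nu>
    by (simp add: algebra_simps power2_eq_square Dm Dr)
qed

text \<open>Three gauge equations are composed: \<open>Q\<close> and its inverse are constant and
  only transport coefficient matrices, while \<open>P\<close> carries \<open>A'\<close> to
  \<open>B'\<close>.\<close>

lemma gauge_conjugate:
  fixes Q P :: "'a::field^'n^'n"
  assumes D: "derivation D" and Q: "invertible Q" "mderiv D Q = 0" "mderiv D (matrix_inv Q) = 0"
    and A: "A ** Q = Q ** A'" and B: "B ** Q = Q ** B'" and P: "mderiv D P + P ** A' = B' ** P"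
  shows "mderiv D (Q ** P ** matrix_inv Q) + Q ** P ** matrix_inv Q ** A = B ** (Q ** P ** matrix_inv Q)"
proof -
  let ?R = "matrix_inv Q"
  have "?R ** A = ?R ** (A ** Q) ** ?R"
    by (simp add: matrix_mul_assoc[symmetric] matrix_inv_field[OF Q(1)])
  also have "\<dots> = A' ** ?R"
    by (simp add: A matrix_mul_assoc matrix_inv_field[OF Q(1)])
  finally have R: "?R ** A = A' ** ?R" .
  have "mderiv D (Q ** P ** ?R) = Q ** mderiv D P ** ?R"
    by (simp add: mderiv_mult[OF D] Q(2,3))
  moreover have "Q ** P ** ?R ** A = Q ** (P ** A') ** ?R"
    by (simp add: matrix_mul_assoc[symmetric] R)
  ultimately have "mderiv D (Q ** P ** ?R) + Q ** P ** ?R ** A = Q ** (mderiv D P + P ** A') ** ?R"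
    by (simp add: matrix_mult_add_left matrix_add_ldistrib)
  also have "\<dots> = B ** (Q ** P ** ?R)"
    unfolding P by (simp add: matrix_mul_assoc B)
  finally show ?thesis .
qed

section \<open>Riccati equations and the transformed potential\<close>

lemma log_derivative_riccati:
  assumes D: "derivation D" and y: "y \<noteq> 0" "D (D y) + p * D y + q * y = 0"
  shows "D (D y / y) = - (D y / y)\<^sup>2 - p * (D y / y) - q"
proof -
  have DD: "D (D y) = - p * D y - q * y" using y(2) by (simp add: add_eq_0_iff2 add.assoc)
  show ?thesis
    using y(1) unfolding derivation_divide[OF D y(1)] DD by (simp add: field_simps power2_eq_square)
qed

text \<open>The element \<open>u = 1 / (y * s)\<close> satisfies
  \<open>D u = (\<rho> + p) * u\<close>, since \<open>D s / s = D r / (2 * r)\<close>. Hence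
  \<open>p * u - D u = - (\<rho> * u)\<close>, and after one more differentiation \<open>u\<close>
  cancels; \<open>y\<close> survives only through the logarithmic derivative inside
  \<open>\<rho>\<close>.\<close>

lemma darboux_potential:
  fixes r :: "'a::field_char_0"
  assumes D: "derivation D" and nz: "y \<noteq> 0" "r \<noteq> 0" and s: "s\<^sup>2 = r"
    and \<rho>: "\<rho> = - (D y / y) - p - D r / (2 * r)"
  shows "y * s * D (p / (y * s) - D (1 / (y * s))) = - D \<rho> - \<rho>\<^sup>2 - p * \<rho>"
proof -
  have "s \<noteq> 0" using s nz(2) by auto
  define u where "u = 1 / (y * s)"
  have u: "y * s * u = 1" using nz(1) \<open>s \<noteq> 0\<close> by (simp add: u_def)
  have "D r = 2 * s * D s"
    using s derivation_mult[OF D, of s s] by (simp add: power2_eq_square)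
  then have "D r / (2 * r) = D s / s"
    using s \<open>s \<noteq> 0\<close> by (auto simp: power2_eq_square)
  then have \<rho>': "\<rho> + p = - (D y / y + D s / s)"
    using \<rho> by simp
  have "D u = - (D y / y + D s / s) * u"
    unfolding u_def using nz(1) \<open>s \<noteq> 0\<close>
    by (simp add: derivation_divide[OF D] derivation_mult[OF D] derivation_1[OF D] field_simps power2_eq_square)
  then have Du: "D u = (\<rho> + p) * u" by (simp only: \<rho>')
  have "p / (y * s) - D (1 / (y * s)) = p * u - D u"
    by (simp add: u_def)
  also have "\<dots> = - (\<rho> * u)" by (simp add: Du algebra_simps)
  finally have "D (p / (y * s) - D (1 / (y * s))) = D (- (\<rho> * u))"
    by (rule arg_cong)
  also have "\<dots> = - (D \<rho> + \<rho> * (\<rho> + p)) * u"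
    by (simp add: derivation_minus[OF D] derivation_mult[OF D] Du algebra_simps)
  finally have "y * s * D (p / (y * s) - D (1 / (y * s))) = - (D \<rho> + \<rho> * (\<rho> + p)) * (y * s * u)"
    by simp
  also have "\<dots> = - D \<rho> - \<rho>\<^sup>2 - p * \<rho>"
    unfolding u by (simp add: algebra_simps power2_eq_square)
  finally show ?thesis .
qed

theorem proposition3p12:
  fixes D :: "'a::field_char_0 \<Rightarrow> 'a"
    and K :: "'a set"
    and \<iota> p q r w y\<^sub>0 s \<theta>\<^sub>0 qt m \<rho> \<nu> :: 'a
    and A\<^sub>0 Y :: "'a^'n^'n"
    and T :: "'a^3^3"
  assumes "derivation D" and "diff_subfield D K"
    and "algebraically_closed (constants D K)"
    and "\<iota> \<in> constants D K" and "\<iota>\<^sup>2 = - 1"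
    and "p \<in> K" and "q \<in> K" and "r \<in> K" and "r \<noteq> 0"
    and "w \<in> K" and "w \<noteq> 0" and "p = D w / w"
    and "picard_vessiot D K A\<^sub>0 Y" and "y\<^sub>0 \<in> adjoin K (entries Y)"
    and "y\<^sub>0 \<noteq> 0" and "D (D y\<^sub>0) + p * D y\<^sub>0 + q * y\<^sub>0 = 0"
    and "\<theta>\<^sub>0 = D y\<^sub>0 / y\<^sub>0"
    and "s\<^sup>2 = r"
    and "qt = y\<^sub>0 * s * D (p / (y\<^sub>0 * s) - D (1 / (y\<^sub>0 * s)))"
    and "m \<in> constants D K" and "m \<noteq> 0"
    and "\<rho> = - \<theta>\<^sub>0 - p - D r / (2 * r)"
    and "\<nu> = m * r - \<theta>\<^sub>0 * \<rho>"
    and "T = matQ \<iota> ** matP r \<theta>\<^sub>0 \<rho> \<nu> ** matrix_inv (matQ \<iota>)"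
  shows "invertible (matQ \<iota>)
    \<and> T = mscale (1 / (2 * r)) (vector
        [vector [- (\<nu>\<^sup>2) + \<rho>\<^sup>2 + \<theta>\<^sub>0\<^sup>2 - 1, \<iota> * (\<nu>\<^sup>2 + \<rho>\<^sup>2 - \<theta>\<^sub>0\<^sup>2 - 1), 2 * (\<nu> * \<rho> + \<theta>\<^sub>0)],
         vector [\<iota> * (\<nu>\<^sup>2 - \<rho>\<^sup>2 + \<theta>\<^sub>0\<^sup>2 - 1), \<nu>\<^sup>2 + \<rho>\<^sup>2 + \<theta>\<^sub>0\<^sup>2 + 1, 2 * \<iota> * (\<theta>\<^sub>0 - \<nu> * \<rho>)],
         vector [2 * (\<nu> * \<theta>\<^sub>0 + \<rho>), - (2 * \<iota> * (\<nu> * \<theta>\<^sub>0 - \<rho>)), 2 * (\<nu> - \<theta>\<^sub>0 * \<rho>)]])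
    \<and> gauge_transformation D T (Sys \<iota> p q r m) (Sys \<iota> p qt r m)
    \<and> Omega0 \<iota> p qt \<in> so3 (adjoin K {\<theta>\<^sub>0})
    \<and> (algebraic_over K \<theta>\<^sub>0 \<longrightarrow>
        (\<forall>Z. picard_vessiot D K (Sys \<iota> p q r m) Z \<longrightarrow>
          picard_vessiot D (adjoin K {\<theta>\<^sub>0}) (Sys \<iota> p qt r m) (T ** Z) \<and>
          galois_identity_component D K Z
            = galois_identity_component D (adjoin K {\<theta>\<^sub>0}) (T ** Z)))
    \<and> (\<theta>\<^sub>0 \<in> K \<longrightarrow>
        (\<forall>Z. picard_vessiot D K (Sys \<iota> p q r m) Z \<longrightarrow>
          picard_vessiot D K (Sys \<iota> p qt r m) (T ** Z) \<and>
          diff_galois_group D K Z = diff_galois_group D K (T ** Z)))"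
proof -
  have D: "derivation D" and dK: "diff_subfield D K" and C: "algebraically_closed (constants D K)"
    and \<iota>: "\<iota> \<in> constants D K" and \<iota>2: "\<iota>\<^sup>2 = - 1" and pqr: "p \<in> K" "q \<in> K" "r \<in> K" "r \<noteq> 0"
    and y: "y\<^sub>0 \<noteq> 0" "D (D y\<^sub>0) + p * D y\<^sub>0 + q * y\<^sub>0 = 0" and \<theta>: "\<theta>\<^sub>0 = D y\<^sub>0 / y\<^sub>0"
    and s: "s\<^sup>2 = r" and m: "m \<in> constants D K" "m \<noteq> 0"
    and \<rho>: "\<rho> = - \<theta>\<^sub>0 - p - D r / (2 * r)" and \<nu>: "\<nu> = m * r - \<theta>\<^sub>0 * \<rho>"
    and T: "T = matQ \<iota> ** matP r \<theta>\<^sub>0 \<rho> \<nu> ** matrix_inv (matQ \<iota>)"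
    by fact+
  let ?A = "Sys \<iota> p q r m" and ?B = "Sys \<iota> p qt r m" and ?K = "adjoin K {\<theta>\<^sub>0}"
  have D\<theta>: "D \<theta>\<^sub>0 = - \<theta>\<^sub>0\<^sup>2 - p * \<theta>\<^sub>0 - q"
    unfolding \<theta> by (rule log_derivative_riccati[OF D y])
  \<comment> \<open>Solved for \<open>D \<rho>\<close>, this is the Riccati equation of
    \<open>\<rho>\<close>. It also places \<open>qt\<close> in \<open>K(\<theta>\<^sub>0)\<close>,
    although its definition involves \<open>y\<^sub>0\<close> and the square root
    \<open>s\<close>.\<close>
  have qt: "qt = - D \<rho> - \<rho>\<^sup>2 - p * \<rho>"
    unfolding \<open>qt = _\<close> by (rule darboux_potential[OF D y(1) pqr(4) s \<rho>[unfolded \<theta>]])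
  then have D\<rho>: "D \<rho> = - \<rho>\<^sup>2 - p * \<rho> - qt" by simp
  have const: "D \<iota> = 0" "D m = 0" and \<iota>m: "\<iota> \<in> K" "m \<in> K"
    using \<iota> m(1) by (auto simp: constants_def)
  note Q = matQ_inverse[OF \<iota>2]
  have D_half: "D (1 / 2) = 0" "D (\<iota> / 2) = 0"
    by (simp_all add: derivation_divide[OF D] derivation_1[OF D] derivation_numeral[OF D] const)
  have DQ: "mderiv D (matQ \<iota>) = 0" "mderiv D (matrix_inv (matQ \<iota>)) = 0"
    unfolding Q(2)
    by (simp_all add: matrix_3_eq_iff forall_3 mderiv_def matQ_def matQ_inv_def derivation_0[OF D]
        derivation_1[OF D] derivation_minus[OF D] const D_half)
  have "mderiv D T + T ** ?A = ?B ** T"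
    unfolding T
    by (rule gauge_conjugate[OF D Q(1) DQ Sys_matQ[OF \<iota>2] Sys_matQ[OF \<iota>2]
          matP_gauge[OF D pqr(4) const(2) D\<theta> \<rho> D\<rho> \<nu>]])
  moreover have "invertible T"
    unfolding T by (intro invertible_mult Q(1) invertible_matrix_inv invertible_matP[OF pqr(4) m(2) \<nu>])
  ultimately have gauge: "gauge_transformation D T ?A ?B"
    by (intro gauge_transformationI D)

  have sub: "is_subfield ?K" by (rule subfield_adjoin)
  note cl = subfield_closed[OF sub]
  have KK: "K \<subseteq> ?K" by (rule adjoin_superset)
  have in_K: "p \<in> ?K" "q \<in> ?K" "r \<in> ?K" "\<iota> \<in> ?K" "m \<in> ?K" "D r \<in> ?K" "\<theta>\<^sub>0 \<in> ?K"
    using KK pqr \<iota>m dK generators_adjoin[of "{\<theta>\<^sub>0}" K] by (auto simp: diff_subfield_def)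
  \<comment> \<open>The Riccati equation makes \<open>K(\<theta>\<^sub>0)\<close> closed under
    \<open>D\<close>.\<close>
  have D\<theta>_K: "D \<theta>\<^sub>0 \<in> ?K" unfolding D\<theta> by (intro cl in_K)
  have dK': "diff_subfield D ?K"
    using D\<theta>_K by (intro diff_subfield_adjoin[OF D dK]) auto
  have \<rho>_K: "\<rho> \<in> ?K" unfolding \<rho> by (intro cl in_K)
  have \<nu>_K: "\<nu> \<in> ?K" unfolding \<nu> by (intro cl in_K \<rho>_K)
  have "D \<rho> \<in> ?K" using dK' \<rho>_K by (auto simp: diff_subfield_def)
  then have qt_K: "qt \<in> ?K" unfolding qt by (intro cl in_K \<rho>_K)
  have Q_K: "entries (matQ \<iota>) \<subseteq> ?K"
    by (simp add: entries_subset_iff forall_3 matQ_def cl in_K)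
  have "entries (matP r \<theta>\<^sub>0 \<rho> \<nu>) \<subseteq> ?K"
    by (simp add: entries_subset_iff forall_3 matP_def mscale_nth cl in_K \<rho>_K \<nu>_K)
  then have T_K: "entries T \<subseteq> ?K"
    unfolding T by (intro entries_matrix_mult sub Q_K entries_matrix_inv Q(1))
  have B_K: "entries ?B \<subseteq> ?K"
    by (simp add: entries_subset_iff forall_3 Sys_def Omega0_def N3_def mscale_nth cl in_K qt_K)
  have so3: "Omega0 \<iota> p qt \<in> so3 ?K"
    by (simp add: so3_def entries_subset_iff matrix_3_eq_iff forall_3 Omega0_def transpose_def
        cl in_K qt_K)

  \<comment> \<open>The base field is enlarged first, which keeps \<open>Z\<close> and the identity
    component; the larger field contains the entries of \<open>T\<close>, and there the gauge step
    preserves the whole group.\<close>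
  have alg: "picard_vessiot D ?K ?B (T ** Z) \<and>
      galois_identity_component D K Z = galois_identity_component D ?K (T ** Z)"
    if "algebraic_over K \<theta>\<^sub>0" and PV: "picard_vessiot D K ?A Z" for Z
  proof -
    note ext = galois_identity_component_adjoin[OF D C PV that(1) D\<theta>_K]
    note gal = gauge_preserves_galois_group[OF D ext(1) gauge T_K B_K]
    show ?thesis
      using gal(1) ext(2) by (simp add: galois_identity_component_def gal(2))
  qed
  have rat: "picard_vessiot D K ?B (T ** Z) \<and> diff_galois_group D K Z = diff_galois_group D K (T ** Z)"
    if "\<theta>\<^sub>0 \<in> K" and PV: "picard_vessiot D K ?A Z" for Z
  proof -
    \<comment> \<open>No extension occurs, so the gauge step applies over \<open>K\<close>
      itself.\<close>
    have "?K = K"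
      using that(1) dK by (intro adjoin_absorb) (auto simp: diff_subfield_def)
    then show ?thesis
      using gauge_preserves_galois_group[OF D PV gauge] T_K B_K by auto
  qed
  show ?thesis
    using Q(1) matQ_conjugate_matP[OF \<iota>2 pqr(4)] T gauge so3 alg rat by blast
qed

end
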